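(* (Adaptive soft-thresholding with consistent tuning) Suppose that for given $i\ge1$ satisfying $i\le k=k(n)$ for large enough $n$ we have $\xi_{i,n}\eta_{i,n}\to0$ and $n^{1/2}\eta_{i,n}\to\infty$. Set the scaling factor $\alpha_{i,n}=(\xi_{i,n}\eta_{i,n})^{-1}$. Suppose that the true parameters $\theta^{(n)}=(\theta_{1,n},\dots,\theta_{k_n,n})\in\mathbb{R}^{k_n}$ (with $k_n=k(n)$) and $\sigma_n\in(0,\infty)$ satisfy $\theta_{i,n}/(\sigma_n\xi_{i,n}\eta_{i,n})\to\zeta_i\in\bar{\mathbb{R}}$. Let $H_n$ denote the cdf of $\sigma_n^{-1}\alpha_{i,n}(\tilde\theta_{AS,i}-\theta_{i,n})$ under $P_{n,\theta^{(n)},\sigma_n}$. (a) Suppose $n-k$ is eventually constant equal to $m$, say. Then $H_n$ converges weakly to the distribution with cdf $$\int_{\sqrt{|x\zeta_i|}}^\infty\rho_m(s)\,ds\,\mathbf{1}(-\zeta_i\le x<0)+\mathbf{1}(x\ge0)=\Pr(\chi_m^2>m|x\zeta_i|)\mathbf{1}(-\zeta_i\le x<0)+\mathbf{1}(x\ge0)$$ in case $0\le\zeta_i<\infty$, and to the distribution with cdf $$\int_0^{\sqrt{|x\zeta_i|}}\rho_m(s)\,ds\,\mathbf{1}(0\le x<-\zeta_i)+\mathbf{1}(x\ge-\zeta_i)=\Pr(\chi_m^2\le m|x\zeta_i|)\mathbf{1}(0\le x<-\zeta_i)+\mathbf{1}(x\ge-\zeta_i)$$ in case $-\infty<\zeta_i<0$.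 Furthermore, $H_n$ converges weakly to $\delta_0$ if $|\zeta_i|=\infty$. (In case $|\zeta_i|<\infty$, the limit distribution has a jump of height $\int_{|\zeta_i|}^\infty\rho_m(s)\,ds=\Pr(\chi_m^2>m\zeta_i^2)$ at $x=-\zeta_i$ and is otherwise absolutely continuous. In particular, it reduces to $\delta_0$ in case $\zeta_i=0$.) (b) If $n-k\to\infty$, then 1. $|\zeta_i|\le1$ implies that $H_n$ converges weakly to $\delta_{-\zeta_i}$, 2. $1<|\zeta_i|<\infty$ implies that $H_n$ converges weakly to $\delta_{-1/\zeta_i}$, 3. $|\zeta_i|=\infty$ implies that $H_n$ converges weakly to $\delta_0$.
   Context: For each sample size $n$ consider the linear regression model $Y=X\theta+u$, where $X$ is a nonstochastic $n\times k$ matrix of rank $k\ge1$ with $k<n$, $\theta\in\mathbb{R}^k$, $u\sim N(0,\sigma^2I_n)$, $0<\sigma<\infty$. The number $k=k(n)$, the entries of $X,Y,u$ and the underlying probability space may depend on $n$. $P_{n,\theta,\sigma}$ denotes probability under parameters $\theta,\sigma$. $X'$ is the transpose of $X$. $\xi_{i,n}$ is the nonnegative square root of the $i$-th diagonal element of $(X'X/n)^{-1}$. $\hat\theta_{LS}=(X'X)^{-1}X'Y$ with $i$-th component $\hat\theta_{LS,i}$, and $\hat\sigma^2=(n-k)^{-1}(Y-X\hat\theta_{LS})'(Y-X\hat\theta_{LS})$, $\hat\sigma\ge0$. The tuning parameters $\eta_{i,n}$ are positive real numbers. The adaptive soft-thresholding estimator is $\tilde\theta_{AS,i}=\hat\theta_{LS,i}(1-\hat\sigma^2\xi_{i,n}^2\eta_{i,n}^2/\hat\theta_{LS,i}^2)_+$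 (i.e. $0$ if $|\hat\theta_{LS,i}|\le\hat\sigma\xi_{i,n}\eta_{i,n}$, and $\hat\theta_{LS,i}-\hat\sigma^2\xi_{i,n}^2\eta_{i,n}^2/\hat\theta_{LS,i}$ otherwise), $(\cdot)_+=\max(\cdot,0)$. Standing assumption for all asymptotics: $\sup_n\xi_{j,n}^2/n<\infty$ for every fixed $j\ge1$ satisfying $j\le k(n)$ for large enough $n$. $\bar{\mathbb{R}}=\mathbb{R}\cup\{-\infty,\infty\}$; $\delta_z$ is pointmass at $z$. $\chi_m^2$ denotes a chi-square random variable with $m$ degrees of freedom; $\rho_m$ is the density of $m^{-1/2}$ times the square root of a $\chi_m^2$ random variable, with $\rho_m(s)=0$ for $s<0$. *)

theory Defs
  imports
    "HOL-Probability.Probability"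
    "Jordan_Normal_Form.Gauss_Jordan_Elimination"
    "Jordan_Normal_Form.DL_Rank"
begin

text \<open>
  Vectors and matrices are those of \<open>Jordan_Normal_Form\<close>, since both dimensions of the regressor
  matrix vary with the sample size. Components are indexed from 0.
\<close>

no_notation vec_nth (infixl \<open>$\<close> 90)
hide_type (open) Finite_Cartesian_Product.vec

definition xi :: "real mat \<Rightarrow> nat \<Rightarrow> real" where
  "xi X i = sqrt (the (mat_inverse ((1 / real (dim_row X)) \<cdot>\<^sub>m (transpose_mat X * X))) $$ (i, i))"

definition theta_LS :: "real mat \<Rightarrow> real vec \<Rightarrow> real vec" where
  "theta_LS X y = the (mat_inverse (transpose_mat X * X)) *\<^sub>v (transpose_mat X *\<^sub>v y)"

definition sigma_hat :: "real mat \<Rightarrow> real vec \<Rightarrow> real" where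
  "sigma_hat X y =
     sqrt (((y - X *\<^sub>v theta_LS X y) \<bullet> (y - X *\<^sub>v theta_LS X y)) / real (dim_row X - dim_col X))"

text \<open>
  If the least-squares component is 0, the quotient is 0 by the convention for division by zero,
  but the leading factor makes the value 0, as required.
\<close>

definition theta_AS :: "real mat \<Rightarrow> (nat \<Rightarrow> real) \<Rightarrow> real vec \<Rightarrow> nat \<Rightarrow> real" where
  "theta_AS X \<eta> y i =
     theta_LS X y $ i *
       max 0 (1 - (sigma_hat X y)\<^sup>2 * (xi X i)\<^sup>2 * (\<eta> i)\<^sup>2 / (theta_LS X y $ i)\<^sup>2)"

text \<open>
  The random vector \<open>u\<close> on \<open>M\<close> is \<open>N(0, \<sigma>\<^sup>2 I\<^sub>n)\<close>-distributed; \<open>normal_density\<close> takes the standard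
  deviation as its second argument.
\<close>

definition normal_errors :: "'a measure \<Rightarrow> nat \<Rightarrow> real \<Rightarrow> ('a \<Rightarrow> real vec) \<Rightarrow> bool" where
  "normal_errors M n \<sigma> u \<longleftrightarrow>
     (\<forall>\<omega>\<in>space M. u \<omega> \<in> carrier_vec n) \<and>
     prob_space.indep_vars M (\<lambda>_. borel) (\<lambda>j \<omega>. u \<omega> $ j) {..<n} \<and>
     (\<forall>j<n. distributed M lborel (\<lambda>\<omega>. u \<omega> $ j) (normal_density 0 \<sigma>))"

definition linear_regression ::
    "'a measure \<Rightarrow> nat \<Rightarrow> nat \<Rightarrow> real mat \<Rightarrow> real vec \<Rightarrow> real \<Rightarrow> ('a \<Rightarrow> real vec) \<Rightarrow> ('a \<Rightarrow> real vec) \<Rightarrow> bool" where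
  "linear_regression M n k X \<theta> \<sigma> u Y \<longleftrightarrow>
     prob_space M \<and> 1 \<le> k \<and> k < n \<and>
     X \<in> carrier_mat n k \<and> vec_space.rank n X = k \<and>
     \<theta> \<in> carrier_vec k \<and> 0 < \<sigma> \<and>
     normal_errors M n \<sigma> u \<and>
     (\<forall>\<omega>\<in>space M. Y \<omega> = X *\<^sub>v \<theta> + u \<omega>)"

definition chi_square :: "nat \<Rightarrow> real measure" where
  "chi_square m =
     distr (Pi\<^sub>M {..<m} (\<lambda>_. std_normal_distribution)) borel (\<lambda>z. \<Sum>j<m. (z j)\<^sup>2)"

definition rho :: "nat \<Rightarrow> real \<Rightarrow> real" where
  "rho m s =
     (if s < 0 then 0
      else enn2real (RN_deriv lborel (distr (chi_square m) borel (\<lambda>x. sqrt x / sqrt (real m))) s))"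

end

theory Submission
  imports Defs
begin

text \<open>
  One map governs the estimator. Put \<open>shrink L q = L * min 1 (q / L\<^sup>2)\<close>, so that adaptive soft
  thresholding of \<open>L\<close> with squared threshold \<open>q\<close> returns \<open>L - shrink L q\<close>. Divide every quantity by
  \<open>\<sigma> * xi * \<eta>\<close>: the parameter becomes \<open>t\<close>, which tends to \<open>\<zeta>\<close>, the least squares component becomes
  \<open>t + W\<close>, and the squared threshold becomes \<open>q\<close>, the ratio of estimated to true error variance.
  The random variable with cdf \<open>H n\<close> is then exactly \<open>W - shrink (t + W) q\<close>
  (\<open>linear_regression_canonical_form\<close>). Here \<open>W\<close> has mean square \<open>1 / (n * \<eta>\<^sup>2)\<close> and so vanishes in
  probability by the tuning condition, while \<open>(n - k) * q\<close> is chi-square distributed with \<open>n - k\<close>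
  degrees of freedom. Since \<open>W\<close> is negligible, only the marginal law of \<open>q\<close> matters for the limit.

  The map \<open>shrink\<close> is 1-Lipschitz in its first argument, uniformly in \<open>q\<close> (\<open>shrink_lipschitz\<close>). For
  finite \<open>\<zeta>\<close> the variable is therefore \<open>- shrink \<zeta> q\<close> up to an error that vanishes in probability, and
  \<open>weak_conv_slutsky\<close> reduces everything to the law of \<open>q\<close>. With a fixed number of degrees of
  freedom that law does not depend on \<open>n\<close>, and the limit is the law of \<open>- shrink \<zeta> (\<chi>\<^sup>2 / m)\<close>, called
  \<open>limit_law\<close> below; its cdf, atom and absolutely continuous part can be read off from
  \<open>shrink z q = min z (q / z)\<close> for positive \<open>z\<close>. When the degrees of freedom grow, \<open>q\<close> tends to 1 by
  Chebyshev's inequality and the limit is the point mass at \<open>- shrink \<zeta> 1\<close>. When \<open>\<zeta>\<close> is infinite,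
  \<open>\<bar>shrink t q\<bar> \<le> q / \<bar>t\<bar>\<close> together with \<open>E q = 1\<close> gives the limit 0 in both regimes.

  The law of \<open>q\<close> comes from two facts. Algebraically, the residual sum of squares is the squared
  length of \<open>V u\<close>, where the rows of \<open>V\<close> are an orthonormal basis of the orthogonal complement of the
  columns of \<open>X\<close> (\<open>residual_sum_of_squares\<close>). Probabilistically, the squared length of \<open>V z\<close> is
  chi-square distributed for a standard Gaussian vector \<open>z\<close>
  (\<open>sum_squares_orthonormal_eq_chi_square\<close>): integrating \<open>exp (i s (w \<bullet> V z))\<close> over independent Gaussian
  vectors \<open>w\<close> and \<open>z\<close>, in either order, shows that the two laws have the same Laplace transform.
\<close>

section \<open>Gaussian quadratic forms\<close>

abbreviation std_gaussian :: "nat \<Rightarrow> (nat \<Rightarrow> real) measure" where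
  "std_gaussian n \<equiv> Pi\<^sub>M {..<n} (\<lambda>_. std_normal_distribution)"

interpretation std_normal: real_distribution std_normal_distribution
  by (rule real_dist_normal_dist)

interpretation std_normal_product: product_sigma_finite "\<lambda>_::nat. std_normal_distribution"
  by (intro product_sigma_finite.intro std_normal.sigma_finite_measure_axioms)

lemma prob_space_std_gaussian: "prob_space (std_gaussian n)"
  by (intro prob_space_PiM std_normal.prob_space_axioms)

lemma measurable_std_gaussian_component [simp]:
  "j < n \<Longrightarrow> (\<lambda>z. z j) \<in> borel_measurable (std_gaussian n)"
  by (rule measurable_PiM_component_rev) (auto simp: measurable_ident_sets)

lemma iexp_sum: "finite I \<Longrightarrow> iexp (\<Sum>i\<in>I. f i) = (\<Prod>i\<in>I. iexp (f i))"
  by (simp add: sum_distrib_left exp_sum)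

lemma char_std_gaussian:
  "(CLINT z|std_gaussian n. iexp (\<Sum>j<n. c j * z j)) = exp (- (\<Sum>j<n. (c j)\<^sup>2) / 2)"
proof -
  have "(CLINT z|std_gaussian n. iexp (\<Sum>j<n. c j * z j))
      = (CLINT z|std_gaussian n. (\<Prod>j<n. iexp (c j * z j)))"
    by (subst iexp_sum) auto
  also have "\<dots> = (\<Prod>j<n. char std_normal_distribution (c j))"
    unfolding char_def
    by (rule std_normal_product.product_integral_prod)
       (auto intro!: std_normal.integrable_const_bound[where B=1])
  also have "\<dots> = complex_of_real (\<Prod>j<n. exp (- ((c j)\<^sup>2) / 2))"
    by (simp only: char_std_normal_distribution of_real_prod)
  also have "(\<Prod>j<n. exp (- ((c j)\<^sup>2) / 2)) = exp (- (\<Sum>j<n. (c j)\<^sup>2) / 2)"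
    by (simp add: exp_sum[symmetric] sum_negf sum_divide_distrib)
  finally show ?thesis .
qed

lemma measurable_linear_comb [measurable]:
  "(\<lambda>z. \<Sum>j<n. c j * z j) \<in> borel_measurable (std_gaussian n)"
  by (intro borel_measurable_sum borel_measurable_times) auto

text \<open>
  For a standard Gaussian \<open>w\<close> the mean of \<open>exp (i s (w \<bullet> y))\<close> is \<open>exp (- s\<^sup>2 \<bar>y\<bar>\<^sup>2 / 2)\<close>, so the left-hand
  side is a double integral of \<open>exp (i s (w \<bullet> V z))\<close>. Integrating over \<open>z\<close> first leaves the mean of
  \<open>exp (- s\<^sup>2 \<bar>V\<^sup>T w\<bar>\<^sup>2 / 2)\<close> over \<open>w\<close>, and \<open>V\<^sup>T\<close> preserves lengths.
\<close>

lemma laplace_orthonormal_quadratic_form: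
  fixes V :: "nat \<Rightarrow> nat \<Rightarrow> real"
  assumes V: "\<And>a b. a < r \<Longrightarrow> b < r \<Longrightarrow> (\<Sum>j<n. V a j * V b j) = (if a = b then 1 else 0)"
  shows "(LINT z|std_gaussian n. exp (- (\<Sum>a<r. (s * (\<Sum>j<n. V a j * z j))\<^sup>2) / 2))
       = (LINT w|std_gaussian r. exp (- (\<Sum>a<r. (s * w a)\<^sup>2) / 2))"
proof -
  interpret N: prob_space "std_gaussian n" by (rule prob_space_std_gaussian)
  interpret R: prob_space "std_gaussian r" by (rule prob_space_std_gaussian)
  interpret NR: pair_prob_space "std_gaussian n" "std_gaussian r" ..
  define y where "y z a = (\<Sum>j<n. V a j * z j)" for z :: "nat \<Rightarrow> real" and a
  have y [measurable]: "(\<lambda>z. y z a) \<in> borel_measurable (std_gaussian n)" for a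
    unfolding y_def by measurable
  \<comment> \<open>The bilinear form in \<open>w\<close> and \<open>V z\<close>, read as a linear form in \<open>z\<close>.\<close>
  have swap: "(\<Sum>a<r. s * y z a * w a) = (\<Sum>j<n. s * (\<Sum>a<r. w a * V a j) * z j)" for z w
  proof -
    have "(\<Sum>a<r. s * y z a * w a) = (\<Sum>a<r. \<Sum>j<n. s * V a j * z j * w a)"
      by (simp add: y_def sum_distrib_left sum_distrib_right mult_ac)
    also have "\<dots> = (\<Sum>j<n. \<Sum>a<r. s * V a j * z j * w a)"
      by (rule sum.swap)
    also have "\<dots> = (\<Sum>j<n. s * (\<Sum>a<r. w a * V a j) * z j)"
      by (simp add: sum_distrib_left sum_distrib_right mult_ac)
    finally show ?thesis .
  qed
  \<comment> \<open>The rows of \<open>V\<close> are orthonormal, so its transpose is an isometry.\<close>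
  have iso: "(\<Sum>j<n. (s * (\<Sum>a<r. w a * V a j))\<^sup>2) = (\<Sum>a<r. (s * w a)\<^sup>2)" for w
  proof -
    have "(\<Sum>j<n. (s * (\<Sum>a<r. w a * V a j))\<^sup>2)
        = (\<Sum>j<n. \<Sum>a<r. \<Sum>b<r. s\<^sup>2 * w a * w b * (V a j * V b j))"
      by (simp add: power2_eq_square sum_product sum_distrib_left mult_ac)
    also have "\<dots> = (\<Sum>a<r. \<Sum>b<r. \<Sum>j<n. s\<^sup>2 * w a * w b * (V a j * V b j))"
      by (subst sum.swap) (auto intro!: sum.cong sum.swap)
    also have "\<dots> = (\<Sum>a<r. \<Sum>b<r. s\<^sup>2 * w a * w b * (if a = b then 1 else 0))"
      by (intro sum.cong refl) (simp add: sum_distrib_left[symmetric] V)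
    also have "\<dots> = (\<Sum>a<r. (s * w a)\<^sup>2)"
      by (simp add: power2_eq_square mult_ac if_distrib sum.If_cases cong: if_cong)
    finally show ?thesis .
  qed
  have int: "integrable (std_gaussian n \<Otimes>\<^sub>M std_gaussian r)
      (\<lambda>(z, w). iexp (\<Sum>a<r. s * y z a * w a))"
  proof (rule NR.integrable_const_bound[where B=1])
    have "(\<lambda>p. \<Sum>a<r. s * y (fst p) a * snd p a)
        \<in> borel_measurable (std_gaussian n \<Otimes>\<^sub>M std_gaussian r)"
    proof (rule borel_measurable_sum)
      fix a assume "a \<in> {..<r}"
      hence "(\<lambda>w. w a) \<in> borel_measurable (std_gaussian r)" by simp
      note [measurable] = measurable_compose[OF measurable_snd this]
        measurable_compose[OF measurable_fst y[of a]]
      show "(\<lambda>p. s * y (fst p) a * snd p a)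
          \<in> borel_measurable (std_gaussian n \<Otimes>\<^sub>M std_gaussian r)" by measurable
    qed
    from measurable_compose[OF this, of "\<lambda>x. iexp x" borel]
    show "(\<lambda>(z, w). iexp (\<Sum>a<r. s * y z a * w a))
        \<in> borel_measurable (std_gaussian n \<Otimes>\<^sub>M std_gaussian r)"
      unfolding case_prod_beta by simp
  qed (simp add: case_prod_beta)
  have "complex_of_real (LINT z|std_gaussian n. exp (- (\<Sum>a<r. (s * y z a)\<^sup>2) / 2))
      = (CLINT z|std_gaussian n. CLINT w|std_gaussian r. iexp (\<Sum>a<r. s * y z a * w a))"
    unfolding char_std_gaussian by (simp add: integral_complex_of_real)
  also have "\<dots> = (CLINT w|std_gaussian r. CLINT z|std_gaussian n. iexp (\<Sum>a<r. s * y z a * w a))"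
    by (rule NR.Fubini_integral[OF int, symmetric])
  also have "\<dots> = complex_of_real (LINT w|std_gaussian r. exp (- (\<Sum>a<r. (s * w a)\<^sup>2) / 2))"
    unfolding swap char_std_gaussian iso by (simp add: integral_complex_of_real)
  finally show ?thesis
    unfolding y_def of_real_eq_iff .
qed

lemma exp_neg_power_eq: "exp (- x) ^ k = exp (- (real k * x))" for x :: real
  by (simp add: exp_of_nat_mult[symmetric])

text \<open>
  The values of the transform at the natural numbers are the moments of \<open>exp (- x)\<close>, which lives in
  the unit interval. Polynomials are dense in the continuous functions there, so the integrals of all
  continuous step functions agree, and these sandwich the cdf.
\<close>

lemma laplace_unique:
  assumes "real_distribution \<mu>" "real_distribution \<nu>"
    and nonneg: "AE x in \<mu>. 0 \<le> x" "AE x in \<nu>. 0 \<le> x"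
    and laplace: "\<And>k::nat. (LINT x|\<mu>. exp (- (real k * x))) = (LINT x|\<nu>. exp (- (real k * x)))"
  shows "\<mu> = \<nu>"
proof -
  interpret m: real_distribution \<mu> by fact
  interpret n: real_distribution \<nu> by fact
  have step: "integral\<^sup>L \<mu> (cts_step x y) = integral\<^sup>L \<nu> (cts_step x y)" if "x < y" for x y
  proof -
    \<comment> \<open>The step function in the variable \<open>exp (- x)\<close>. It vanishes for \<open>x \<ge> y\<close>, that is near the
      end point 0, which is why it extends continuously to the closed unit interval.\<close>
    define \<phi> where "\<phi> t = (if t \<le> 0 then 0 else cts_step x y (- ln t))" for t
    have cts: "continuous_on {0..1} \<phi>"
    proof -
      have U: "{0..1::real} = {0..exp (- y)} \<inter> {0..1} \<union> {exp (- y)..1}"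
        using exp_gt_zero[of "-y"] by (auto simp del: exp_gt_zero)
      have "isCont (cts_step x y) t" for t
        using uniformly_continuous_imp_continuous[OF cts_step_uniformly_continuous[OF that]]
        by (simp add: continuous_on_eq_continuous_at)
      hence cs: "continuous_on S (cts_step x y)" for S
        by (simp add: continuous_at_imp_continuous_on)
      have "continuous_on {exp (- y)..1} (\<lambda>t. cts_step x y (- ln t))"
        by (rule continuous_on_compose2[OF cs[of UNIV]])
           (auto intro!: continuous_intros dest!: order.strict_trans2[OF exp_gt_zero])
      hence 1: "continuous_on {exp (- y)..1} \<phi>"
        by (rule continuous_on_eq) (auto simp: \<phi>_def dest!: order.strict_trans2[OF exp_gt_zero])
      have "\<phi> t = 0" if "t \<le> exp (- y)" for t
      proof (cases "t \<le> 0")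
        case False
        hence "ln t \<le> - y" using that by (simp add: ln_ge_iff ln_le_cancel_iff[of t "exp (-y)", symmetric] del: ln_le_cancel_iff)
        thus ?thesis using False \<open>x < y\<close> by (simp add: \<phi>_def cts_step_def)
      qed (simp add: \<phi>_def)
      hence 2: "continuous_on ({0..exp (- y)} \<inter> {0..1}) \<phi>"
        by (intro continuous_on_eq[OF continuous_on_const[of _ 0]]) auto
      show ?thesis
        by (subst U, rule continuous_on_closed_Un) (use 1 2 in auto)
    qed
    have close: "\<bar>integral\<^sup>L \<mu> (cts_step x y) - integral\<^sup>L \<nu> (cts_step x y)\<bar> \<le> 2 * e"
      if "0 < e" for e
    proof -
      obtain g where g: "real_polynomial_function g" "\<And>t. t \<in> {0..1} \<Longrightarrow> \<bar>\<phi> t - g t\<bar> < e"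
        using Stone_Weierstrass_real_polynomial_function[OF _ cts \<open>0 < e\<close>] by (metis compact_Icc)
      then obtain a d where gs: "g = (\<lambda>t. \<Sum>i\<le>d. a i * t ^ i)"
        by (auto simp: real_polynomial_function_iff_sum)
      have ge: "g (exp (- t)) = (\<Sum>i\<le>d. a i * exp (- (real i * t)))" for t
        by (simp add: gs exp_neg_power_eq)
      have approx: "\<bar>integral\<^sup>L P (cts_step x y) - (\<Sum>i\<le>d. a i * (LINT t|P. exp (- (real i * t))))\<bar> \<le> e"
        if P: "real_distribution P" and nn: "AE t in P. 0 \<le> t" for P
      proof -
        interpret p: real_distribution P by fact
        have ie: "integrable P (\<lambda>t. exp (- (real i * t)))" for i
          by (rule p.integrable_const_bound[where B=1])
             (use nn in auto)
        have ig: "integrable P (\<lambda>t. g (exp (- t)))"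
          unfolding ge by (intro Bochner_Integration.integrable_sum integrable_mult_right ie)
        have "(\<Sum>i\<le>d. a i * (LINT t|P. exp (- (real i * t)))) = (LINT t|P. g (exp (- t)))"
          unfolding ge using ie by (subst Bochner_Integration.integral_sum) auto
        moreover have "\<bar>(LINT t|P. cts_step x y t) - (LINT t|P. g (exp (- t)))\<bar> \<le> (LINT t|P. e)"
        proof -
          have "\<bar>(LINT t|P. cts_step x y t) - (LINT t|P. g (exp (- t)))\<bar>
              = \<bar>LINT t|P. cts_step x y t - g (exp (- t))\<bar>"
            using p.integrable_cts_step[OF \<open>x < y\<close>] ig by simp
          also have "\<dots> \<le> (LINT t|P. \<bar>cts_step x y t - g (exp (- t))\<bar>)"
            by (rule integral_abs_bound)
          also have "\<dots> \<le> (LINT t|P. e)"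
          proof (rule integral_mono_AE)
            show "AE t in P. \<bar>cts_step x y t - g (exp (- t))\<bar> \<le> e"
              using nn
            proof eventually_elim
              case (elim t)
              have "\<phi> (exp (- t)) = cts_step x y t" by (simp add: \<phi>_def)
              thus ?case using g(2)[of "exp (- t)"] elim by auto
            qed
          qed (use p.integrable_cts_step[OF \<open>x < y\<close>] ig in auto)
          finally show ?thesis .
        qed
        ultimately show ?thesis using p.prob_space by (simp add: p.prob_space)
      qed
      show ?thesis
        using approx[OF assms(1) nonneg(1)] approx[OF assms(2) nonneg(2)] laplace by simp
    qed
    show ?thesis
    proof (rule ccontr)
      assume "\<not> ?thesis"
      then show False
        using close[of "\<bar>integral\<^sup>L \<mu> (cts_step x y) - integral\<^sup>L \<nu> (cts_step x y)\<bar> / 4"] by simp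
    qed
  qed
  have le: "cdf P x \<le> cdf Q x"
    if P: "real_distribution P" and Q: "real_distribution Q"
      and st: "\<And>x y. x < y \<Longrightarrow> integral\<^sup>L P (cts_step x y) = integral\<^sup>L Q (cts_step x y)" for P Q x
  proof (rule tendsto_lowerbound)
    interpret q: real_distribution Q by fact
    show "(cdf Q \<longlongrightarrow> cdf Q x) (at_right x)"
      using q.cdf_is_right_cont[of x] by (simp add: continuous_within)
    have "cdf P x \<le> cdf Q y" if "x < y" for y
      using real_distribution.cdf_cts_step[OF P that] q.cdf_cts_step[OF that] st[OF that] by linarith
    thus "\<forall>\<^sub>F y in at_right x. cdf P x \<le> cdf Q y"
      by (auto simp: eventually_at_right_field intro: exI[of _ "x + 1"])
  qed simp
  show ?thesis
    by (rule cdf_unique) (use assms le[OF assms(1,2) step] le[OF assms(2,1) step[symmetric]] in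
        \<open>auto simp: fun_eq_iff intro: antisym\<close>)
qed

lemma sum_squares_orthonormal_eq_chi_square:
  fixes V :: "nat \<Rightarrow> nat \<Rightarrow> real"
  assumes V: "\<And>a b. a < r \<Longrightarrow> b < r \<Longrightarrow> (\<Sum>j<n. V a j * V b j) = (if a = b then 1 else 0)"
  shows "distr (std_gaussian n) borel (\<lambda>z. \<Sum>a<r. (\<Sum>j<n. V a j * z j)\<^sup>2) = chi_square r"
    (is "distr _ _ ?q = _")
proof (rule laplace_unique)
  interpret N: prob_space "std_gaussian n" by (rule prob_space_std_gaussian)
  interpret R: prob_space "std_gaussian r" by (rule prob_space_std_gaussian)
  have mq [measurable]: "?q \<in> borel_measurable (std_gaussian n)"
    by (intro borel_measurable_sum borel_measurable_power) measurable
  have mc [measurable]: "(\<lambda>z. \<Sum>a<r. (z a)\<^sup>2) \<in> borel_measurable (std_gaussian r)"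
    by (intro borel_measurable_sum borel_measurable_power) auto
  show "real_distribution (distr (std_gaussian n) borel ?q)"
    by (rule N.real_distribution_distr) simp
  show "real_distribution (chi_square r)"
    unfolding chi_square_def by (rule R.real_distribution_distr) simp
  show "AE x in distr (std_gaussian n) borel ?q. 0 \<le> x"
    by (subst AE_distr_iff) (auto intro!: AE_I2 sum_nonneg)
  show "AE x in chi_square r. 0 \<le> x"
    unfolding chi_square_def by (subst AE_distr_iff) (auto intro!: AE_I2 sum_nonneg)
  fix k :: nat
  have scale: "- (real k * (\<Sum>a<r. (f a)\<^sup>2)) = - (\<Sum>a<r. (sqrt (2 * real k) * f a)\<^sup>2) / 2" for f
    by (simp add: power_mult_distrib sum_distrib_left[symmetric])
  \<comment> \<open>The transform at \<open>k\<close> is the Gaussian double integral with frequency \<open>sqrt (2 * k)\<close>.\<close>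
  show "(LINT x|distr (std_gaussian n) borel ?q. exp (- (real k * x)))
      = (LINT x|chi_square r. exp (- (real k * x)))"
    unfolding chi_square_def
    by (subst (1 2) integral_distr; (simp only: scale laplace_orthonormal_quadratic_form[OF V])?) auto
qed

section \<open>Moments of the chi-square distribution\<close>

text \<open>
  Independent centred variables are orthogonal, so their weighted sum obeys Pythagoras. With the
  identity for \<open>g\<close> this gives the variance of a least squares coefficient, with \<open>g x = x\<^sup>2 - 1\<close> the
  variance of the chi-square distribution.
\<close>

lemma
  fixes g :: "real \<Rightarrow> real"
  assumes g: "integrable std_normal_distribution g"
      "integrable std_normal_distribution (\<lambda>x. (g x)\<^sup>2)"
    and mean: "(LINT x|std_normal_distribution. g x) = 0"
  shows integrable_square_centered_sum:
      "integrable (std_gaussian n) (\<lambda>z. (\<Sum>j<n. c j * g (z j))\<^sup>2)"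
    and integral_square_centered_sum:
      "(LINT z|std_gaussian n. (\<Sum>j<n. c j * g (z j))\<^sup>2)
         = (\<Sum>j<n. (c j)\<^sup>2) * (LINT x|std_normal_distribution. (g x)\<^sup>2)"
proof -
  \<comment> \<open>The product \<open>g (z i) * g (z j)\<close> as a product over all coordinates \<open>l\<close>, covering both \<open>i = j\<close>
    and \<open>i \<noteq> j\<close>.\<close>
  define F where "F i j l x = (if l = i then g x else 1) * (if l = j then g x else 1)"
    for i j l :: nat and x
  have intF: "integrable std_normal_distribution (F i j l)" for i j l
    unfolding F_def[abs_def] using g
    by (cases "l = i"; cases "l = j") (simp_all add: power2_eq_square)
  have prodF: "(\<Prod>l<n. F i j l (z l)) = g (z i) * g (z j)" if "i < n" "j < n" for i j z
    unfolding F_def prod.distrib using that by simp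
  have int: "integrable (std_gaussian n) (\<lambda>z. g (z i) * g (z j))" if "i < n" "j < n" for i j
    using std_normal_product.product_integrable_prod[of "{..<n}" "F i j"] intF that
    by (simp add: prodF)
  have val: "(LINT z|std_gaussian n. g (z i) * g (z j))
      = (if i = j then (LINT x|std_normal_distribution. (g x)\<^sup>2) else 0)" if "i < n" "j < n" for i j
  proof -
    have "(LINT z|std_gaussian n. g (z i) * g (z j)) = (\<Prod>l<n. integral\<^sup>L std_normal_distribution (F i j l))"
      using std_normal_product.product_integral_prod[of "{..<n}" "F i j"] intF that
      by (simp add: prodF)
    also have "\<dots> = (if i = j then (LINT x|std_normal_distribution. (g x)\<^sup>2) else 0)"
    proof (cases "i = j")
      case True
      have "integral\<^sup>L std_normal_distribution (F i j l)
          = (if l = i then (LINT x|std_normal_distribution. (g x)\<^sup>2) else 1)" for l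
        using True std_normal.prob_space
        by (cases "l = i") (simp_all add: F_def[abs_def] power2_eq_square)
      with True that show ?thesis by simp
    next
      case False
      hence "integral\<^sup>L std_normal_distribution (F i j i) = 0"
        using mean by (simp add: F_def[abs_def])
      with False that show ?thesis by (auto intro!: prod_zero)
    qed
    finally show ?thesis .
  qed
  have expand: "(\<Sum>j<n. c j * g (z j))\<^sup>2 = (\<Sum>i<n. \<Sum>j<n. c i * c j * (g (z i) * g (z j)))" for z
    by (simp add: power2_eq_square sum_product mult_ac)
  show "integrable (std_gaussian n) (\<lambda>z. (\<Sum>j<n. c j * g (z j))\<^sup>2)"
    unfolding expand by (intro Bochner_Integration.integrable_sum integrable_mult_right int) auto
  have "(LINT z|std_gaussian n. (\<Sum>j<n. c j * g (z j))\<^sup>2)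
      = (\<Sum>i<n. (LINT z|std_gaussian n. (\<Sum>j<n. c i * c j * (g (z i) * g (z j)))))"
    unfolding expand
    by (rule Bochner_Integration.integral_sum)
       (intro Bochner_Integration.integrable_sum integrable_mult_right int; simp)
  also have "\<dots> = (\<Sum>i<n. \<Sum>j<n. (LINT z|std_gaussian n. c i * c j * (g (z i) * g (z j))))"
    by (intro sum.cong refl Bochner_Integration.integral_sum integrable_mult_right int; simp)
  also have "\<dots> = (\<Sum>i<n. \<Sum>j<n. c i * c j * (LINT z|std_gaussian n. g (z i) * g (z j)))"
    by simp
  also have "\<dots> = (\<Sum>j<n. (c j)\<^sup>2) * (LINT x|std_normal_distribution. (g x)\<^sup>2)"
  proof -
    have "(\<Sum>j<n. c i * c j * (LINT z|std_gaussian n. g (z i) * g (z j)))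
        = (c i)\<^sup>2 * (LINT x|std_normal_distribution. (g x)\<^sup>2)" if "i < n" for i
    proof -
      have "(\<Sum>j<n. c i * c j * (LINT z|std_gaussian n. g (z i) * g (z j)))
          = (\<Sum>j<n. if i = j then c i * c j * (LINT x|std_normal_distribution. (g x)\<^sup>2) else 0)"
        using that by (intro sum.cong) (simp_all add: val)
      thus ?thesis using that by (simp add: power2_eq_square)
    qed
    thus ?thesis by (simp add: sum_distrib_right)
  qed
  finally show "(LINT z|std_gaussian n. (\<Sum>j<n. c j * g (z j))\<^sup>2)
         = (\<Sum>j<n. (c j)\<^sup>2) * (LINT x|std_normal_distribution. (g x)\<^sup>2)" .
qed

lemma std_normal_moments:
  "integrable std_normal_distribution (\<lambda>x. x ^ k)"
  "(LINT x|std_normal_distribution. x) = 0"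
  "(LINT x|std_normal_distribution. x\<^sup>2) = 1"
  "(LINT x|std_normal_distribution. x ^ 4) = 3"
  using integrable_std_normal_distribution_moment[of k]
    integral_std_normal_distribution_moment_odd[of 1]
    std_normal_distribution_even_moments(1)[of 1] std_normal_distribution_even_moments(1)[of 2]
  by (auto simp: fact_numeral)

lemma
  shows integrable_square_linear_comb:
      "integrable (std_gaussian n) (\<lambda>z. (\<Sum>j<n. c j * z j)\<^sup>2)"
    and integral_square_linear_comb:
      "(LINT z|std_gaussian n. (\<Sum>j<n. c j * z j)\<^sup>2) = (\<Sum>j<n. (c j)\<^sup>2)"
  using integrable_square_centered_sum[of "\<lambda>x. x" n c] integral_square_centered_sum[of "\<lambda>x. x" n c]
    std_normal_moments(1)[of 1] std_normal_moments(1)[of 2] std_normal_moments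
  by simp_all

lemma real_distribution_chi_square: "real_distribution (chi_square m)"
proof -
  interpret prob_space "std_gaussian m" by (rule prob_space_std_gaussian)
  show ?thesis
    unfolding chi_square_def by (rule real_distribution_distr) (auto intro!: borel_measurable_sum borel_measurable_power)
qed

lemma measurable_chi_square_sum [measurable]:
  "(\<lambda>z. \<Sum>a<r. (z a)\<^sup>2) \<in> borel_measurable (std_gaussian r)"
  by (intro borel_measurable_sum borel_measurable_power) auto

lemma AE_chi_square_nonneg: "AE x in chi_square m. 0 \<le> x"
  unfolding chi_square_def by (subst AE_distr_iff) (auto intro!: AE_I2 sum_nonneg)

lemma
  shows integrable_chi_square: "integrable (chi_square m) (\<lambda>x. x)"
    and mean_chi_square: "(LINT x|chi_square m. x) = real m"
    and integrable_chi_square_variance: "integrable (chi_square m) (\<lambda>x. (x - real m)\<^sup>2)"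
    and variance_chi_square: "(LINT x|chi_square m. (x - real m)\<^sup>2) = 2 * real m"
proof -
  have comp: "integrable (std_gaussian m) (\<lambda>z. (z j)\<^sup>2)" "(LINT z|std_gaussian m. (z j)\<^sup>2) = 1"
    if "j < m" for j
  proof -
    have "(\<Sum>i<m. (if i = j then 1 else 0) * z i) = z j" for z :: "nat \<Rightarrow> real"
      using that by (simp add: if_distrib[of "\<lambda>x. x * _"] cong: if_cong)
    moreover have "(\<Sum>i<m. (if i = j then 1 else 0::real)\<^sup>2) = 1"
      using that by (simp add: if_distrib[of "\<lambda>x. x\<^sup>2"] cong: if_cong)
    ultimately show "integrable (std_gaussian m) (\<lambda>z. (z j)\<^sup>2)" "(LINT z|std_gaussian m. (z j)\<^sup>2) = 1"
      using integrable_square_linear_comb[of m "\<lambda>i. if i = j then 1 else 0"]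
        integral_square_linear_comb[of m "\<lambda>i. if i = j then 1 else 0"] by simp_all
  qed
  show "integrable (chi_square m) (\<lambda>x. x)"
    unfolding chi_square_def by (subst integrable_distr_eq) (auto intro!: comp)
  show "(LINT x|chi_square m. x) = real m"
    unfolding chi_square_def
    by (subst integral_distr; (subst Bochner_Integration.integral_sum)?) (auto intro!: comp simp: comp)
  define g :: "real \<Rightarrow> real" where "g x = x\<^sup>2 - 1" for x
  have g2: "(g x)\<^sup>2 = x ^ 4 - 2 * x\<^sup>2 + 1" for x
    by (simp add: g_def power2_eq_square power4_eq_xxxx algebra_simps)
  note mom = std_normal_moments(1)[of 2] std_normal_moments(1)[of 4] std_normal_moments
  have g: "integrable std_normal_distribution g" "(LINT x|std_normal_distribution. g x) = 0"
    "integrable std_normal_distribution (\<lambda>x. (g x)\<^sup>2)" "(LINT x|std_normal_distribution. (g x)\<^sup>2) = 2"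
    unfolding g2 unfolding g_def[abs_def] using mom std_normal.prob_space by simp_all
  have sum_g: "(\<Sum>j<m. 1 * g (z j)) = (\<Sum>j<m. (z j)\<^sup>2) - real m" for z
    by (simp add: g_def sum_subtractf)
  note sq = integrable_square_centered_sum[OF g(1,3,2), of m "\<lambda>_. 1"]
    integral_square_centered_sum[OF g(1,3,2), of m "\<lambda>_. 1"]
  show "integrable (chi_square m) (\<lambda>x. (x - real m)\<^sup>2)"
    unfolding chi_square_def using sq(1) by (subst integrable_distr_eq) (auto simp: sum_g[simplified])
  show "(LINT x|chi_square m. (x - real m)\<^sup>2) = 2 * real m"
    unfolding chi_square_def using sq(2) by (subst integral_distr) (auto simp: sum_g[simplified] g)
qed

lemma chi_square_ratio_moments:
  assumes M: "prob_space M" and q: "q \<in> borel_measurable M" and r: "0 < r"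
    and law: "distr M borel (\<lambda>\<omega>. real r * q \<omega>) = chi_square r"
  shows "integrable M q" "(LINT \<omega>|M. q \<omega>) = 1"
    "integrable M (\<lambda>\<omega>. (q \<omega> - 1)\<^sup>2)" "(LINT \<omega>|M. (q \<omega> - 1)\<^sup>2) = 2 / real r"
proof -
  have m: "(\<lambda>\<omega>. real r * q \<omega>) \<in> borel_measurable M" using q by measurable
  have "integrable (distr M borel (\<lambda>\<omega>. real r * q \<omega>)) (\<lambda>x. x)"
    unfolding law by (rule integrable_chi_square)
  from integrable_mult_right[OF integrable_distr[OF m this], of "1 / real r"]
  show "integrable M q" using r by simp
  have "(LINT x|distr M borel (\<lambda>\<omega>. real r * q \<omega>). x) = (LINT \<omega>|M. real r * q \<omega>)"
    by (rule integral_distr[OF m]) simp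
  hence "real r * (LINT \<omega>|M. q \<omega>) = real r" unfolding law mean_chi_square by simp
  thus "(LINT \<omega>|M. q \<omega>) = 1" using r by simp
  have sq: "(real r * q \<omega> - real r)\<^sup>2 = (real r)\<^sup>2 * (q \<omega> - 1)\<^sup>2" for \<omega>
    by (simp add: power2_eq_square algebra_simps)
  have "integrable (distr M borel (\<lambda>\<omega>. real r * q \<omega>)) (\<lambda>x. (x - real r)\<^sup>2)"
    unfolding law by (rule integrable_chi_square_variance)
  from integrable_mult_right[OF integrable_distr[OF m this], of "1 / (real r)\<^sup>2"]
  show "integrable M (\<lambda>\<omega>. (q \<omega> - 1)\<^sup>2)" using r by (simp add: sq)
  have "(LINT x|distr M borel (\<lambda>\<omega>. real r * q \<omega>). (x - real r)\<^sup>2)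
      = (LINT \<omega>|M. (real r * q \<omega> - real r)\<^sup>2)"
    by (rule integral_distr[OF m]) simp
  hence "(real r)\<^sup>2 * (LINT \<omega>|M. (q \<omega> - 1)\<^sup>2) = 2 * real r"
    unfolding law variance_chi_square sq by simp
  thus "(LINT \<omega>|M. (q \<omega> - 1)\<^sup>2) = 2 / real r"
    using r by (simp add: eq_divide_eq power2_eq_square mult_ac)
qed

section \<open>Absolute continuity of the chi-square distribution and the density rho\<close>

text \<open>
  Differentiable maps of the line send null sets to null sets. The set \<open>B\<close> plays the role of a
  preimage: to see that it is null, cover it by the image of a null set under the inverse map.
\<close>

lemma null_set_lborel_transfer:
  fixes f :: "real \<Rightarrow> real"
  assumes N: "N \<in> null_sets lborel" and f: "f differentiable_on S"
    and B: "B \<in> sets borel" and sub: "B \<subseteq> f ` (N \<inter> S)"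
  shows "B \<in> null_sets lborel"
proof -
  have "negligible (N \<inter> S)"
    using N null_sets_completionI[of N lborel] negligible_subset[of N "N \<inter> S"]
    by (simp add: negligible_iff_null_sets)
  hence "negligible (f ` (N \<inter> S))"
    using differentiable_on_subset[OF f, of "N \<inter> S"]
    by (intro negligible_differentiable_image_negligible) simp_all
  hence "negligible B" using sub by (rule negligible_subset)
  thus ?thesis
    using B by (simp add: negligible_iff_null_sets null_sets_completion_iff)
qed

text \<open>
  Conditionally on all coordinates but one, the sum of squares is \<open>w + y\<^sup>2\<close> with \<open>y\<close> standard normal,
  and \<open>y \<mapsto> w + y\<^sup>2\<close> has differentiable inverse branches away from 0.
\<close>

lemma absolutely_continuous_chi_square:
  assumes "0 < m"
  shows "absolutely_continuous lborel (chi_square m)"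
  unfolding absolutely_continuous_def
proof
  fix N :: "real set" assume N: "N \<in> null_sets lborel"
  hence [measurable]: "N \<in> sets borel" by auto
  obtain k where m: "m = Suc k" using assms by (cases m) auto
  have null: "emeasure std_normal_distribution {y. w + y\<^sup>2 \<in> N} = 0" for w
  proof -
    let ?f = "\<lambda>t. sqrt (t - w)"
    have "?f differentiable (at t)" if "w < t" for t
      unfolding real_differentiable_def using that
      by (intro exI[of _ "inverse (sqrt (t - w)) / 2"]) (auto intro!: derivative_eq_intros)
    hence d: "?f differentiable_on {w<..}" "(\<lambda>t. - ?f t) differentiable_on {w<..}"
      unfolding differentiable_on_def by (simp_all add: differentiable_at_withinI)
    have "{y. w + y\<^sup>2 \<in> N \<and> 0 < y} \<in> null_sets lborel"
    proof (rule null_set_lborel_transfer[OF N d(1)], measurable, rule subsetI)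
      fix y assume y: "y \<in> {y. w + y\<^sup>2 \<in> N \<and> 0 < y}"
      show "y \<in> ?f ` (N \<inter> {w<..})"
        by (rule image_eqI[where x = "w + y\<^sup>2"]) (use y in auto)
    qed
    moreover have "{y. w + y\<^sup>2 \<in> N \<and> y < 0} \<in> null_sets lborel"
    proof (rule null_set_lborel_transfer[OF N d(2)], measurable, rule subsetI)
      fix y assume y: "y \<in> {y. w + y\<^sup>2 \<in> N \<and> y < 0}"
      show "y \<in> (\<lambda>t. - ?f t) ` (N \<inter> {w<..})"
        by (rule image_eqI[where x = "w + y\<^sup>2"]) (use y in auto)
    qed
    moreover have "{0::real} \<in> null_sets lborel" by auto
    ultimately have "{y. w + y\<^sup>2 \<in> N \<and> 0 < y} \<union> {y. w + y\<^sup>2 \<in> N \<and> y < 0} \<union> {0} \<in> null_sets lborel"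
      by blast
    hence "{y. w + y\<^sup>2 \<in> N} \<in> null_sets lborel"
      by (rule null_sets_subset) (auto simp: not_less_iff_gr_or_eq)
    moreover have "absolutely_continuous lborel std_normal_distribution"
      by (rule absolutely_continuousI_density) auto
    ultimately show ?thesis by (auto simp: absolutely_continuous_def)
  qed
  have "emeasure (chi_square m) N = (\<integral>\<^sup>+z. indicator N (\<Sum>j<m. (z j)\<^sup>2) \<partial>std_gaussian m)"
    unfolding chi_square_def
    by (subst nn_integral_indicator[symmetric], simp, subst nn_integral_distr) auto
  also have "\<dots> = (\<integral>\<^sup>+x. \<integral>\<^sup>+y. indicator N (\<Sum>j<m. ((x(k := y)) j)\<^sup>2) \<partial>std_normal_distribution \<partial>std_gaussian k)"
    unfolding m lessThan_Suc
    by (rule std_normal_product.product_nn_integral_insert) (auto simp: lessThan_Suc[symmetric])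
  also have "\<dots> = (\<integral>\<^sup>+x. \<integral>\<^sup>+y. indicator {y. (\<Sum>j<k. (x j)\<^sup>2) + y\<^sup>2 \<in> N} y \<partial>std_normal_distribution \<partial>std_gaussian k)"
    by (intro nn_integral_cong) (auto simp: m indicator_def)
  also have "\<dots> = 0"
    by (simp add: null)
  finally show "N \<in> null_sets (chi_square m)"
    by (auto simp: chi_square_def)
qed

lemma emeasure_chi_square_atMost_0:
  assumes "0 < m"
  shows "emeasure (chi_square m) {..0} = 0"
proof -
  interpret real_distribution "chi_square m" by (rule real_distribution_chi_square)
  have "{0::real} \<in> null_sets lborel" by auto
  hence "{0} \<in> null_sets (chi_square m)"
    using absolutely_continuous_chi_square[OF assms] by (auto simp: absolutely_continuous_def)
  hence "AE x in chi_square m. x \<notin> {0}" by (rule AE_not_in)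
  with AE_chi_square_nonneg[of m] have "AE x in chi_square m. x \<notin> {..0}"
    by eventually_elim auto
  thus ?thesis by (subst (asm) AE_iff_measurable[OF _ refl]) (auto simp: atMost_def)
qed

lemma measure_chi_square_atLeast:
  assumes "0 < m"
  shows "measure (chi_square m) {t..} = measure (chi_square m) {t<..}"
proof -
  interpret real_distribution "chi_square m" by (rule real_distribution_chi_square)
  have "{t} \<in> null_sets lborel" by auto
  hence "{t} \<in> null_sets (chi_square m)"
    using absolutely_continuous_chi_square[OF assms] by (auto simp: absolutely_continuous_def)
  hence "AE x in chi_square m. x \<notin> {t}" by (rule AE_not_in)
  thus ?thesis by (intro finite_measure_eq_AE) (auto elim!: eventually_mono)
qed

abbreviation scaled_chi :: "nat \<Rightarrow> real measure" where
  "scaled_chi m \<equiv> distr (chi_square m) borel (\<lambda>x. sqrt x / sqrt (real m))"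

lemma sets_chi_square [measurable_cong, simp]: "sets (chi_square m) = sets borel"
  by (simp add: chi_square_def)

lemma space_chi_square [simp]: "space (chi_square m) = UNIV"
  by (simp add: chi_square_def)

lemma absolutely_continuous_scaled_chi:
  assumes "0 < m"
  shows "absolutely_continuous lborel (scaled_chi m)"
  unfolding absolutely_continuous_def
proof
  fix N :: "real set" assume N: "N \<in> null_sets lborel"
  hence [measurable]: "N \<in> sets borel" by auto
  have "{x. sqrt x / sqrt (real m) \<in> N \<and> 0 < x} \<in> null_sets lborel"
  proof (rule null_set_lborel_transfer[OF N, of "\<lambda>s. real m * s\<^sup>2" UNIV], goal_cases)
    case 1
    have "(\<lambda>s. real m * s\<^sup>2) differentiable (at s)" for s
      unfolding real_differentiable_def
      by (intro exI[of _ "real m * (2 * s)"]) (auto intro!: derivative_eq_intros)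
    thus ?case by (simp add: differentiable_on_def)
  next
    case 2 show ?case by measurable
  next
    case 3 show ?case
    proof
      fix x assume x: "x \<in> {x. sqrt x / sqrt (real m) \<in> N \<and> 0 < x}"
      show "x \<in> (\<lambda>s. real m * s\<^sup>2) ` (N \<inter> UNIV)"
        by (rule image_eqI[where x = "sqrt x / sqrt (real m)"])
           (use x assms in \<open>auto simp: power_divide\<close>)
    qed
  qed
  hence "{x. sqrt x / sqrt (real m) \<in> N \<and> 0 < x} \<in> null_sets (chi_square m)"
    using absolutely_continuous_chi_square[OF assms] by (auto simp: absolutely_continuous_def)
  moreover have "{..0} \<in> null_sets (chi_square m)"
    using emeasure_chi_square_atMost_0[OF assms] by auto
  ultimately have "{x. sqrt x / sqrt (real m) \<in> N \<and> 0 < x} \<union> {..0} \<in> null_sets (chi_square m)"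
    by blast
  hence "{x. sqrt x / sqrt (real m) \<in> N} \<in> null_sets (chi_square m)"
    by (rule null_sets_subset) (auto simp: not_less)
  thus "N \<in> null_sets (scaled_chi m)"
    by (subst null_sets_distr_iff) (auto simp: vimage_def)
qed

text \<open>
  On the nonnegative half-line \<open>rho\<close> is the Radon-Nikodym derivative of the law of \<open>sqrt (\<chi>\<^sup>2 / m)\<close>;
  absolute continuity of that law makes integrating the derivative recover it.
\<close>

lemma set_integral_rho:
  assumes "0 < m" and A: "A \<in> sets borel" "A \<subseteq> {0..}"
  shows "(LINT s:A|lborel. rho m s) = measure (scaled_chi m) A"
proof -
  interpret C: real_distribution "chi_square m" by (rule real_distribution_chi_square)
  interpret S: real_distribution "scaled_chi m" by (rule C.real_distribution_distr) simp
  let ?f = "RN_deriv lborel (scaled_chi m)"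
  note ac = absolutely_continuous_scaled_chi[OF assms(1)]
  have [measurable]: "A \<in> sets borel" by fact
  have fin: "AE s in lborel. ?f s \<noteq> \<infinity>"
    by (rule sigma_finite_measure.RN_deriv_finite[OF sigma_finite_lborel S.sigma_finite_measure_axioms ac]) simp
  have "(LINT s:A|lborel. rho m s) = (LINT s|lborel. enn2real (?f s * indicator A s))"
    unfolding set_lebesgue_integral_def
    by (rule Bochner_Integration.integral_cong)
       (use A(2) in \<open>auto simp: rho_def indicator_def\<close>)
  also have "\<dots> = enn2real (\<integral>\<^sup>+s. ennreal (enn2real (?f s * indicator A s)) \<partial>lborel)"
    by (rule integral_eq_nn_integral) auto
  also have "(\<integral>\<^sup>+s. ennreal (enn2real (?f s * indicator A s)) \<partial>lborel)
      = (\<integral>\<^sup>+s. ?f s * indicator A s \<partial>lborel)"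
    by (rule nn_integral_cong_AE) (use fin in \<open>auto elim!: eventually_mono simp: indicator_def less_top\<close>)
  also have "\<dots> = emeasure (density lborel ?f) A"
    by (simp add: emeasure_density)
  also have "density lborel ?f = scaled_chi m"
    by (rule sigma_finite_measure.density_RN_deriv[OF sigma_finite_lborel ac]) simp
  finally show ?thesis by (simp add: measure_def)
qed

lemma sqrt_le_sqrt_div_iff: "0 < m \<Longrightarrow> sqrt t \<le> sqrt x / sqrt (real m) \<longleftrightarrow> real m * t \<le> x"
  "0 < m \<Longrightarrow> sqrt x / sqrt (real m) \<le> sqrt t \<longleftrightarrow> x \<le> real m * t"
  by (simp_all add: real_sqrt_divide[symmetric] pos_le_divide_eq pos_divide_le_eq mult.commute)

lemma set_integral_rho_atLeast:
  assumes "0 < m" "0 \<le> t"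
  shows "(LINT s:{sqrt t..}|lborel. rho m s) = measure (chi_square m) {real m * t<..}"
proof -
  have "(LINT s:{sqrt t..}|lborel. rho m s) = measure (scaled_chi m) {sqrt t..}"
    using assms by (intro set_integral_rho) (auto intro: order.trans[OF real_sqrt_ge_zero])
  also have "\<dots> = measure (chi_square m) {real m * t..}"
    by (subst measure_distr, measurable)
       (use assms in \<open>auto simp: vimage_def sqrt_le_sqrt_div_iff atLeast_def\<close>)
  finally show ?thesis using assms by (simp add: measure_chi_square_atLeast)
qed

lemma set_integral_rho_atLeastAtMost:
  assumes "0 < m" "0 \<le> t"
  shows "(LINT s:{0..sqrt t}|lborel. rho m s) = measure (chi_square m) {..real m * t}"
proof -
  interpret C: real_distribution "chi_square m" by (rule real_distribution_chi_square)
  have "(LINT s:{0..sqrt t}|lborel. rho m s) = measure (scaled_chi m) {0..sqrt t}"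
    using assms by (intro set_integral_rho) auto
  also have "\<dots> = measure (chi_square m) {x. 0 \<le> sqrt x / sqrt (real m) \<and> x \<le> real m * t}"
    by (subst measure_distr, measurable)
       (use assms in \<open>auto simp: vimage_def sqrt_le_sqrt_div_iff\<close>)
  also have "\<dots> = measure (chi_square m) {..real m * t}"
    by (rule C.finite_measure_eq_AE) (use AE_chi_square_nonneg[of m] in \<open>auto elim!: eventually_mono\<close>)
  finally show ?thesis .
qed

section \<open>Linear algebra of least squares\<close>

text \<open>
  A repeated column would leave fewer than \<open>k\<close> vectors to span the column space, so the columns are
  distinct and hence independent.
\<close>

lemma full_column_rank_mult_eq_0:
  fixes X :: "real mat"
  assumes X: "X \<in> carrier_mat n k" "vec_space.rank n X = k"
    and v: "v \<in> carrier_vec k" "X *\<^sub>v v = 0\<^sub>v n"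
  shows "v = 0\<^sub>v k"
proof (rule ccontr)
  assume nz: "v \<noteq> 0\<^sub>v k"
  interpret vec_space "TYPE(real)" n .
  have dist: "distinct (cols X)"
  proof (rule ccontr)
    assume nd: "\<not> distinct (cols X)"
    obtain S where S: "maximal S (\<lambda>T. T \<subseteq> set (cols X) \<and> lin_indpt T)"
      using maximal_exists[of "(\<lambda>T. T \<subseteq> set (cols X) \<and> lin_indpt T)" "card (set (cols X))" "{}"]
      by (meson List.finite_set card_mono empty_iff empty_subsetI finite_lin_indpt2 rev_finite_subset)
    hence "card S \<le> card (set (cols X))" by (simp add: card_mono maximal_def)
    also have "\<dots> < k"
      using nd X(1) card_distinct[of "cols X"] card_length[of "cols X"] by fastforce
    finally show False using rank_card_indpt[OF X(1) S] X(2) by simp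
  qed
  show False
    using full_rank_lin_indpt[OF X dist] lin_depI[OF X(1) v(1) nz v(2) dist] by simp
qed

lemma scalar_prod_self_eq_0:
  fixes v :: "real vec"
  assumes "v \<in> carrier_vec n" "scalar_prod v v = 0"
  shows "v = 0\<^sub>v n"
proof -
  have "(\<Sum>i\<in>{0..<n}. v $ i * v $ i) = 0" using assms by (auto simp: scalar_prod_def)
  hence "\<forall>i\<in>{0..<n}. v $ i * v $ i = 0" by (subst (asm) sum_nonneg_eq_0_iff) auto
  thus ?thesis using assms(1) by (intro eq_vecI) auto
qed

lemma mat_inverse_eqI:
  fixes A :: "real mat"
  assumes "A \<in> carrier_mat n n" "B \<in> carrier_mat n n" "A * B = 1\<^sub>m n"
  shows "mat_inverse A = Some B"
proof -
  have BA: "B * A = 1\<^sub>m n" by (rule mat_mult_left_right_inverse[OF assms])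
  hence "A \<in> Units (ring_mat TYPE(real) n ())"
    using assms by (auto simp: Units_def ring_mat_def)
  then obtain C where C: "mat_inverse A = Some C"
    using mat_inverse(1)[OF assms(1), of "()"] by (cases "mat_inverse A") auto
  from mat_inverse(2)[OF assms(1) C] have "A * C = 1\<^sub>m n" "C \<in> carrier_mat n n" by auto
  hence "C = (B * A) * C" using BA by simp
  also have "\<dots> = B * (A * C)" using assms \<open>C \<in> _\<close> by (intro assoc_mult_mat) auto
  also have "\<dots> = B" using \<open>A * C = _\<close> assms by simp
  finally show ?thesis using C by simp
qed

text \<open>
  If \<open>X\<^sup>T X v = 0\<close> then \<open>\<bar>X v\<bar>\<^sup>2 = v \<bullet> X\<^sup>T X v = 0\<close>, so \<open>v = 0\<close> by full column rank.
\<close>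

lemma gram_inverse_exists:
  fixes X :: "real mat"
  assumes X: "X \<in> carrier_mat n k" "vec_space.rank n X = k"
  obtains B where "B \<in> carrier_mat k k" "transpose_mat X * X * B = 1\<^sub>m k"
proof -
  let ?G = "transpose_mat X * X"
  have G: "?G \<in> carrier_mat k k" using X by auto
  have "det ?G \<noteq> 0"
  proof
    assume "det ?G = 0"
    then obtain v where v: "v \<in> carrier_vec k" "v \<noteq> 0\<^sub>v k" "?G *\<^sub>v v = 0\<^sub>v k"
      using det_0_iff_vec_prod_zero_field[OF G] by auto
    have Xv: "X *\<^sub>v v \<in> carrier_vec n" using X(1) by (rule mult_mat_vec_carrier) (rule v(1))
    have "scalar_prod (X *\<^sub>v v) (X *\<^sub>v v) = scalar_prod (transpose_mat X *\<^sub>v (X *\<^sub>v v)) v"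
      using transpose_vec_mult_scalar[OF X(1) v(1) Xv] by simp
    also have "transpose_mat X *\<^sub>v (X *\<^sub>v v) = 0\<^sub>v k"
      using v X by (subst assoc_mult_mat_vec[symmetric]) auto
    finally have "X *\<^sub>v v = 0\<^sub>v n"
      using v Xv by (intro scalar_prod_self_eq_0) auto
    with full_column_rank_mult_eq_0[OF X v(1)] v(2) show False by simp
  qed
  hence "?G \<in> Units (ring_mat TYPE(real) k ())" by (rule det_non_zero_imp_unit[OF G])
  then obtain B where "mat_inverse ?G = Some B"
    using mat_inverse(1)[OF G, of "()"] by (cases "mat_inverse ?G") auto
  with mat_inverse(2)[OF G] that show ?thesis by blast
qed

text \<open>
  Fewer than \<open>n\<close> vectors in dimension \<open>n\<close>, padded by zero rows to a square matrix, have determinant 0;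
  a normalized kernel vector of that matrix is orthogonal to all of them.
\<close>

lemma orthogonal_vector_exists:
  fixes w :: "nat \<Rightarrow> real vec"
  assumes "m < n" "\<And>i. i < m \<Longrightarrow> w i \<in> carrier_vec n"
  obtains v where "v \<in> carrier_vec n" "scalar_prod v v = 1" "\<And>i. i < m \<Longrightarrow> scalar_prod (w i) v = 0"
proof -
  define A where "A = mat_of_rows n (map (\<lambda>i. if i < m then w i else 0\<^sub>v n) [0..<n])"
  have A: "A \<in> carrier_mat n n" by (rule carrier_matI) (simp_all add: A_def)
  have row: "row A i = (if i < m then w i else 0\<^sub>v n)" if "i < n" for i
    using that assms(2) by (auto simp: A_def)
  have "transpose_mat A *\<^sub>v unit_vec n m = 0\<^sub>v n"
  proof (rule eq_vecI)
    fix j assume j: "j < dim_vec (0\<^sub>v n :: real vec)"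
    hence "(transpose_mat A *\<^sub>v unit_vec n m) $ j = A $$ (m, j)"
      using A assms(1) by auto
    also have "\<dots> = row A m $ j" using A j assms(1) by simp
    finally show "(transpose_mat A *\<^sub>v unit_vec n m) $ j = 0\<^sub>v n $ j"
      using row[OF assms(1)] j by simp
  qed (use A in auto)
  moreover have "unit_vec n m \<noteq> (0\<^sub>v n :: real vec)"
    using assms(1) by (simp add: vec_eq_iff unit_vec_def)
  ultimately have "det (transpose_mat A) = 0"
    using A by (intro det_0_iff_vec_prod_zero_field[THEN iffD2] exI[of _ "unit_vec n m"]) auto
  hence "det A = 0" using det_transpose[OF A] by simp
  then obtain v where v: "v \<in> carrier_vec n" "v \<noteq> 0\<^sub>v n" "A *\<^sub>v v = 0\<^sub>v n"
    using det_0_iff_vec_prod_zero_field[OF A] by auto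
  define c where "c = scalar_prod v v"
  have "0 \<le> c" by (auto simp: c_def scalar_prod_def intro!: sum_nonneg)
  moreover have "c \<noteq> 0" using scalar_prod_self_eq_0[OF v(1)] v(2) by (auto simp: c_def)
  ultimately have c: "0 < c" by simp
  show ?thesis
  proof
    show "(1 / sqrt c) \<cdot>\<^sub>v v \<in> carrier_vec n" using v by simp
    show "scalar_prod ((1 / sqrt c) \<cdot>\<^sub>v v) ((1 / sqrt c) \<cdot>\<^sub>v v) = 1"
      using v c by (simp add: c_def[symmetric] field_simps)
    fix i assume i: "i < m"
    have "scalar_prod (w i) v = (A *\<^sub>v v) $ i"
      using A i assms row[of i] by simp
    also have "\<dots> = 0" using v i assms by simp
    finally show "scalar_prod (w i) ((1 / sqrt c) \<cdot>\<^sub>v v) = 0"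
      using v assms(2)[OF i] by simp
  qed
qed

lemma orthonormal_complement_exists:
  fixes X :: "real mat"
  assumes X: "X \<in> carrier_mat n k"
  shows "k + r \<le> n \<Longrightarrow> \<exists>V :: nat \<Rightarrow> real vec.
    (\<forall>a<r. V a \<in> carrier_vec n) \<and>
    (\<forall>a<r. \<forall>b<r. scalar_prod (V a) (V b) = (if a = b then 1 else 0)) \<and>
    (\<forall>a<r. \<forall>i<k. scalar_prod (col X i) (V a) = 0)"
proof (induction r)
  case (Suc r)
  have "k + r \<le> n" using Suc.prems by simp
  from Suc.IH[OF this] obtain V :: "nat \<Rightarrow> real vec" where
    V': "\<forall>a<r. V a \<in> carrier_vec n"
      "\<forall>a<r. \<forall>b<r. scalar_prod (V a) (V b) = (if a = b then 1 else 0)"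
      "\<forall>a<r. \<forall>i<k. scalar_prod (col X i) (V a) = 0"
    by blast
  note V = V'[rule_format]
  have "(if i < k then col X i else V (i - k)) \<in> carrier_vec n" if "i < k + r" for i
    using that X V(1)[of "i - k"] by auto
  then obtain v where v: "v \<in> carrier_vec n" "scalar_prod v v = 1"
    "\<And>i. i < k + r \<Longrightarrow> scalar_prod (if i < k then col X i else V (i - k)) v = 0"
    using orthogonal_vector_exists[of "k + r" n "\<lambda>i. if i < k then col X i else V (i - k)"] Suc.prems
    by auto
  have vX: "scalar_prod (col X i) v = 0" if "i < k" for i using v(3)[of i] that by simp
  have vV: "scalar_prod (V a) v = 0" "scalar_prod v (V a) = 0" if "a < r" for a
    using v(3)[of "k + a"] that comm_scalar_prod[OF V(1)[OF that] v(1)] by auto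
  show ?case
    by (rule exI[of _ "V(r := v)"]) (use V v vX vV in \<open>auto simp: less_Suc_eq\<close>)
qed simp

text \<open>
  The residual vector \<open>e\<close> is orthogonal to the columns of \<open>X\<close>, so it lies in the span of the \<open>V a\<close>, and
  its coordinates there are those of \<open>u\<close> because \<open>e\<close> and \<open>u\<close> differ by a combination of columns of \<open>X\<close>.
  That the columns of \<open>X\<close> and the \<open>V a\<close> together span the whole space is seen by exhibiting a right
  inverse of the square matrix that they form, which is then also a left inverse.
\<close>

lemma residual_sum_of_squares:
  fixes X B :: "real mat" and V :: "nat \<Rightarrow> real vec"
  assumes X: "X \<in> carrier_mat n k" and B: "B \<in> carrier_mat k k" "transpose_mat X * X * B = 1\<^sub>m k"
    and kn: "k \<le> n"
    and V: "\<And>a. a < n - k \<Longrightarrow> V a \<in> carrier_vec n"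
      "\<And>a b. a < n - k \<Longrightarrow> b < n - k \<Longrightarrow> scalar_prod (V a) (V b) = (if a = b then 1 else 0)"
      "\<And>a i. a < n - k \<Longrightarrow> i < k \<Longrightarrow> scalar_prod (col X i) (V a) = 0"
    and u: "u \<in> carrier_vec n"
  defines "e \<equiv> u - X *\<^sub>v (B *\<^sub>v (transpose_mat X *\<^sub>v u))"
  shows "scalar_prod e e = (\<Sum>a<n - k. (scalar_prod (V a) u)\<^sup>2)"
proof -
  let ?r = "n - k"
  define S where "S = mat_of_cols n (map V [0..<?r])"
  have S: "S \<in> carrier_mat n ?r" by (rule carrier_matI) (simp_all add: S_def)
  have colS: "col S a = V a" if "a < ?r" for a using that V(1) by (simp add: S_def)
  have SS: "transpose_mat S * S = 1\<^sub>m ?r"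
    by (rule eq_matI) (use S V(2) in \<open>auto simp: colS\<close>)
  have XS: "transpose_mat X * S = 0\<^sub>m k ?r"
    by (rule eq_matI) (use S X V(3) in \<open>auto simp: colS\<close>)
  have SX: "transpose_mat S * X = 0\<^sub>m ?r k"
    using transpose_mult[of "transpose_mat X" k n S ?r] X S by (simp add: XS)
  have XB: "X * B \<in> carrier_mat n k" using X B by auto
  define P where "P = mat_of_rows n (map (\<lambda>i. if i < k then col X i else V (i - k)) [0..<n])"
  define Q where "Q = mat_of_cols n (map (\<lambda>j. if j < k then col (X * B) j else V (j - k)) [0..<n])"
  have P: "P \<in> carrier_mat n n" by (rule carrier_matI) (simp_all add: P_def)
  have Q: "Q \<in> carrier_mat n n" by (rule carrier_matI) (simp_all add: Q_def)
  have rowP: "row P i = (if i < k then col X i else V (i - k))" if "i < n" for i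
    using that X V(1)[of "i - k"] by (auto simp: P_def)
  have colQ: "col Q j = (if j < k then col (X * B) j else V (j - k))" if "j < n" for j
    using that XB V(1)[of "j - k"] by (auto simp: Q_def)
  have XXB: "scalar_prod (col X i) (col (X * B) j) = (if i = j then 1 else 0)" if "i < k" "j < k" for i j
  proof -
    have "transpose_mat X * (X * B) = 1\<^sub>m k"
      using assoc_mult_mat[of "transpose_mat X" k n X k B k] X B by simp
    from arg_cong[OF this, of "\<lambda>M. M $$ (i, j)"] show ?thesis using that X B by simp
  qed
  have VXB: "scalar_prod (V a) (col (X * B) j) = 0" if "a < ?r" "j < k" for a j
  proof -
    have "transpose_mat S * (X * B) = 0\<^sub>m ?r k"
      using assoc_mult_mat[of "transpose_mat S" ?r n X k B k] X S B SX by simp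
    from arg_cong[OF this, of "\<lambda>M. M $$ (a, j)"] show ?thesis using that S X B by (simp add: colS)
  qed
  have "P * Q = 1\<^sub>m n"
    by (rule eq_matI) (use P Q V kn in \<open>auto simp: rowP colQ XXB VXB\<close>)
  hence QP: "Q * P = 1\<^sub>m n" by (rule mat_mult_left_right_inverse[OF P Q])
  define p where "p = B *\<^sub>v (transpose_mat X *\<^sub>v u)"
  have p: "p \<in> carrier_vec k" using B X u by (auto simp: p_def)
  have Xp: "X *\<^sub>v p \<in> carrier_vec n" using X p by auto
  have e: "e \<in> carrier_vec n" "e = u - X *\<^sub>v p" using u Xp by (auto simp: e_def p_def)
  have Xe: "transpose_mat X *\<^sub>v e = 0\<^sub>v k"
  proof -
    have "transpose_mat X *\<^sub>v (X *\<^sub>v p) = (transpose_mat X * X * B) *\<^sub>v (transpose_mat X *\<^sub>v u)"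
    proof -
      have w: "transpose_mat X *\<^sub>v u \<in> carrier_vec k" using X u by auto
      have G: "transpose_mat X * X \<in> carrier_mat k k" using X by auto
      have "transpose_mat X *\<^sub>v (X *\<^sub>v p) = (transpose_mat X * X) *\<^sub>v p"
        using X p by (intro assoc_mult_mat_vec[symmetric]) auto
      also have "\<dots> = (transpose_mat X * X * B) *\<^sub>v (transpose_mat X *\<^sub>v u)"
        unfolding p_def by (rule assoc_mult_mat_vec[OF G B(1) w, symmetric])
      finally show ?thesis .
    qed
    also have "\<dots> = transpose_mat X *\<^sub>v u"
      unfolding B(2) using X u by (intro one_mult_mat_vec) auto
    finally show ?thesis
      unfolding e(2) using X u Xp by (subst mult_minus_distrib_mat_vec[of _ k n]) auto
  qed
  have Se: "transpose_mat S *\<^sub>v e = transpose_mat S *\<^sub>v u"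
  proof -
    have "transpose_mat S *\<^sub>v (X *\<^sub>v p) = (transpose_mat S * X) *\<^sub>v p"
      using S X p by simp
    also have "\<dots> = 0\<^sub>v ?r"
      unfolding SX by (rule eq_vecI) (use p in \<open>auto simp: scalar_prod_def\<close>)
    finally show ?thesis
      unfolding e(2) using S u Xp by (subst mult_minus_distrib_mat_vec[of _ ?r n]) auto
  qed
  define y where "y = transpose_mat S *\<^sub>v u"
  have y: "y \<in> carrier_vec ?r" using S u by (auto simp: y_def)
  have Sy: "S *\<^sub>v y \<in> carrier_vec n" using S y by auto
  \<comment> \<open>The part of \<open>e\<close> outside the span of the \<open>V a\<close>; it is orthogonal to everything, hence zero.\<close>
  define d where "d = e - S *\<^sub>v y"
  have d: "d \<in> carrier_vec n" using e Sy by (auto simp: d_def)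
  have Xd: "transpose_mat X *\<^sub>v d = 0\<^sub>v k"
  proof -
    have "transpose_mat X *\<^sub>v (S *\<^sub>v y) = (transpose_mat X * S) *\<^sub>v y" using X S y by simp
    also have "\<dots> = 0\<^sub>v k"
      unfolding XS by (rule eq_vecI) (use y in \<open>auto simp: scalar_prod_def\<close>)
    finally show ?thesis
      unfolding d_def using X e(1) Sy Xe by (subst mult_minus_distrib_mat_vec[of _ k n]) auto
  qed
  have Sd: "transpose_mat S *\<^sub>v d = 0\<^sub>v ?r"
  proof -
    have "transpose_mat S *\<^sub>v (S *\<^sub>v y) = (transpose_mat S * S) *\<^sub>v y" using S y by simp
    also have "\<dots> = y" using SS y by simp
    finally show ?thesis
      unfolding d_def using S e(1) Sy Se y
      by (subst mult_minus_distrib_mat_vec[of _ ?r n]) (auto simp: y_def)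
  qed
  have "P *\<^sub>v d = 0\<^sub>v n"
  proof (rule eq_vecI)
    fix i assume "i < dim_vec (0\<^sub>v n :: real vec)"
    hence i: "i < n" by simp
    show "(P *\<^sub>v d) $ i = 0\<^sub>v n $ i"
    proof (cases "i < k")
      case True
      from arg_cong[OF Xd, of "\<lambda>v. v $ i"] show ?thesis using True X P i by (simp add: rowP)
    next
      case False
      from arg_cong[OF Sd, of "\<lambda>v. v $ (i - k)"] show ?thesis
        using False S P i by (simp add: rowP colS)
    qed
  qed (use P in auto)
  moreover have "Q *\<^sub>v 0\<^sub>v n = 0\<^sub>v n"
    by (rule eq_vecI) (use Q in \<open>auto simp: scalar_prod_def\<close>)
  ultimately have "(Q * P) *\<^sub>v d = 0\<^sub>v n" using P Q d by simp
  hence "d = 0\<^sub>v n" using QP d by simp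
  have "e = d + S *\<^sub>v y" using e(1) S by (intro eq_vecI) (auto simp: d_def)
  hence e_eq: "e = S *\<^sub>v y" using \<open>d = 0\<^sub>v n\<close> Sy by simp
  have "scalar_prod e e = scalar_prod (transpose_mat S *\<^sub>v e) y"
    using transpose_vec_mult_scalar[OF S y e(1)] e_eq by simp
  also have "\<dots> = scalar_prod y y" by (simp only: Se y_def)
  also have "\<dots> = (\<Sum>a<?r. (scalar_prod (V a) u)\<^sup>2)"
  proof -
    have "y $ a = scalar_prod (V a) u" if "a < ?r" for a
      using that S by (simp add: y_def colS)
    thus ?thesis using y by (simp add: scalar_prod_def[of y y] power2_eq_square lessThan_atLeast0)
  qed
  finally show ?thesis .
qed

text \<open>
  The scaling by \<open>n\<close> in the definition of \<open>xi\<close> passes through the matrix inverse.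
\<close>

lemma xi_gram_inverse:
  fixes X :: "real mat"
  assumes X: "X \<in> carrier_mat n k" and B: "B \<in> carrier_mat k k" "transpose_mat X * X * B = 1\<^sub>m k"
    and n: "0 < n" and i: "i < k"
  shows "xi X i = sqrt (real n * B $$ (i, i))"
proof -
  let ?G = "transpose_mat X * X"
  have G: "?G \<in> carrier_mat k k" using X by auto
  have "(1 / real n) \<cdot>\<^sub>m ?G * (real n \<cdot>\<^sub>m B) = (1 / real n) \<cdot>\<^sub>m (?G * (real n \<cdot>\<^sub>m B))"
    using G B by (intro mult_smult_assoc_mat) auto
  also have "?G * (real n \<cdot>\<^sub>m B) = real n \<cdot>\<^sub>m (?G * B)"
    using G B by (intro mult_smult_distrib) auto
  also have "?G * B = 1\<^sub>m k" by fact
  also have "(1 / real n) \<cdot>\<^sub>m (real n \<cdot>\<^sub>m 1\<^sub>m k) = (1\<^sub>m k :: real mat)"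
    using n by (intro eq_matI) auto
  finally have "mat_inverse ((1 / real n) \<cdot>\<^sub>m ?G) = Some (real n \<cdot>\<^sub>m B)"
    using G B by (intro mat_inverse_eqI[of _ k]) auto
  thus ?thesis using X B i by (simp add: xi_def)
qed

text \<open>
  The coefficients \<open>c\<close> form row \<open>i\<close> of \<open>A = (X\<^sup>T X)\<^sup>-\<^sup>1 X\<^sup>T\<close>. Since \<open>A A\<^sup>T\<close> is the (transposed) inverse Gram
  matrix, the squared length of that row is its \<open>i\<close>-th diagonal entry, and it is positive because
  \<open>A X = 1\<close> prevents the row from vanishing.
\<close>

lemma least_squares_canonical_form:
  fixes X :: "real mat"
  assumes X: "X \<in> carrier_mat n k" "vec_space.rank n X = k" and kn: "k < n" and i: "i < k"
  obtains c :: "nat \<Rightarrow> real" and V :: "nat \<Rightarrow> nat \<Rightarrow> real" where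
    "0 < xi X i" "(\<Sum>j<n. (c j)\<^sup>2) = (xi X i)\<^sup>2 / real n"
    "\<And>a b. a < n - k \<Longrightarrow> b < n - k \<Longrightarrow> (\<Sum>j<n. V a j * V b j) = (if a = b then 1 else 0)"
    "\<And>\<theta> u. \<theta> \<in> carrier_vec k \<Longrightarrow> u \<in> carrier_vec n \<Longrightarrow>
       theta_LS X (X *\<^sub>v \<theta> + u) $ i = \<theta> $ i + (\<Sum>j<n. c j * u $ j)"
    "\<And>\<theta> u. \<theta> \<in> carrier_vec k \<Longrightarrow> u \<in> carrier_vec n \<Longrightarrow>
       (sigma_hat X (X *\<^sub>v \<theta> + u))\<^sup>2 = (\<Sum>a<n - k. (\<Sum>j<n. V a j * u $ j)\<^sup>2) / real (n - k)"
proof -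
  let ?G = "transpose_mat X * X"
  have G: "?G \<in> carrier_mat k k" and XT: "transpose_mat X \<in> carrier_mat k n" using X by auto
  obtain B where B: "B \<in> carrier_mat k k" "?G * B = 1\<^sub>m k"
    using gram_inverse_exists[OF X] by blast
  have BG: "B * ?G = 1\<^sub>m k" by (rule mat_mult_left_right_inverse[OF G B])
  have inv: "mat_inverse ?G = Some B" by (rule mat_inverse_eqI[OF G B])
  define A where "A = B * transpose_mat X"
  have A: "A \<in> carrier_mat k n" using B(1) XT by (auto simp: A_def)
  have AX: "A * X = 1\<^sub>m k"
    using assoc_mult_mat[OF B(1) XT X(1)] BG by (simp add: A_def)
  have AAT: "A * transpose_mat A = transpose_mat B"
  proof -
    have "transpose_mat A = X * transpose_mat B"
      using transpose_mult[OF B(1) XT] by (simp add: A_def)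
    hence "A * transpose_mat A = (A * X) * transpose_mat B"
      using assoc_mult_mat[OF A X(1), of "transpose_mat B" k] B(1) by simp
    thus ?thesis using AX B(1) by simp
  qed
  define c where "c j = A $$ (i, j)" for j
  have csum: "(\<Sum>j<n. (c j)\<^sup>2) = B $$ (i, i)"
  proof -
    have "(\<Sum>j<n. (c j)\<^sup>2) = (A * transpose_mat A) $$ (i, i)"
      using A i by (simp add: scalar_prod_def c_def power2_eq_square lessThan_atLeast0)
    thus ?thesis using AAT B(1) i by simp
  qed
  have Bpos: "0 < B $$ (i, i)"
  proof (rule ccontr)
    assume "\<not> ?thesis"
    hence "(\<Sum>j<n. (c j)\<^sup>2) = 0" using csum sum_nonneg[of "{..<n}" "\<lambda>j. (c j)\<^sup>2"] by simp
    hence "c j = 0" if "j < n" for j using that by (subst (asm) sum_nonneg_eq_0_iff) auto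
    hence "(A * X) $$ (i, i) = 0"
      using A X i by (simp add: scalar_prod_def c_def)
    thus False using AX i by simp
  qed
  have xi: "xi X i = sqrt (real n * B $$ (i, i))"
    using xi_gram_inverse[OF X(1) B _ i] kn by simp
  obtain V :: "nat \<Rightarrow> real vec" where V': "\<forall>a<n - k. V a \<in> carrier_vec n"
    "\<forall>a<n - k. \<forall>b<n - k. scalar_prod (V a) (V b) = (if a = b then 1 else 0)"
    "\<forall>a<n - k. \<forall>i<k. scalar_prod (col X i) (V a) = 0"
    using orthonormal_complement_exists[OF X(1), of "n - k"] kn by auto
  note V = V'[rule_format]
  have LS: "theta_LS X (X *\<^sub>v \<theta> + u) = \<theta> + B *\<^sub>v (transpose_mat X *\<^sub>v u)"
    if t: "\<theta> \<in> carrier_vec k" and u: "u \<in> carrier_vec n" for \<theta> u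
  proof -
    have XTu: "transpose_mat X *\<^sub>v u \<in> carrier_vec k" using XT u by (rule mult_mat_vec_carrier)
    have Xt: "X *\<^sub>v \<theta> \<in> carrier_vec n" using X(1) t by (rule mult_mat_vec_carrier)
    have Gt: "?G *\<^sub>v \<theta> \<in> carrier_vec k" using G t by (rule mult_mat_vec_carrier)
    have "theta_LS X (X *\<^sub>v \<theta> + u) = B *\<^sub>v (transpose_mat X *\<^sub>v (X *\<^sub>v \<theta> + u))"
      by (simp add: theta_LS_def inv)
    also have "transpose_mat X *\<^sub>v (X *\<^sub>v \<theta> + u) = ?G *\<^sub>v \<theta> + transpose_mat X *\<^sub>v u"
      using mult_add_distrib_mat_vec[OF XT Xt u] assoc_mult_mat_vec[OF XT X(1) t] by simp
    also have "B *\<^sub>v (?G *\<^sub>v \<theta> + transpose_mat X *\<^sub>v u)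
        = B *\<^sub>v (?G *\<^sub>v \<theta>) + B *\<^sub>v (transpose_mat X *\<^sub>v u)"
      by (rule mult_add_distrib_mat_vec[OF B(1) Gt XTu])
    also have "B *\<^sub>v (?G *\<^sub>v \<theta>) = (B * ?G) *\<^sub>v \<theta>"
      by (rule assoc_mult_mat_vec[OF B(1) G t, symmetric])
    also have "\<dots> = \<theta>" unfolding BG using t by simp
    finally show ?thesis .
  qed
  show ?thesis
  proof (rule that[of c "\<lambda>a j. V a $ j"])
    show "0 < xi X i" using xi Bpos kn by simp
    show "(\<Sum>j<n. (c j)\<^sup>2) = (xi X i)\<^sup>2 / real n" using xi Bpos kn csum by simp
    show "(\<Sum>j<n. V a $ j * V b $ j) = (if a = b then 1 else 0)" if "a < n - k" "b < n - k" for a b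
      using V(2)[OF that] V(1)[OF that(2)] by (simp add: scalar_prod_def lessThan_atLeast0)
    fix \<theta> u :: "real vec" assume t: "\<theta> \<in> carrier_vec k" and u: "u \<in> carrier_vec n"
    have XTu: "transpose_mat X *\<^sub>v u \<in> carrier_vec k" using XT u by (rule mult_mat_vec_carrier)
    have BXTu: "B *\<^sub>v (transpose_mat X *\<^sub>v u) \<in> carrier_vec k" using B(1) XTu by (rule mult_mat_vec_carrier)
    have "(B *\<^sub>v (transpose_mat X *\<^sub>v u)) $ i = (A *\<^sub>v u) $ i"
      unfolding A_def assoc_mult_mat_vec[OF B(1) XT u] ..
    also have "\<dots> = (\<Sum>j<n. c j * u $ j)"
      using A i u by (simp add: scalar_prod_def c_def lessThan_atLeast0)
    finally show "theta_LS X (X *\<^sub>v \<theta> + u) $ i = \<theta> $ i + (\<Sum>j<n. c j * u $ j)"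
      using LS[OF t u] B(1) i by simp
    define e where "e = u - X *\<^sub>v (B *\<^sub>v (transpose_mat X *\<^sub>v u))"
    have "X *\<^sub>v (\<theta> + B *\<^sub>v (transpose_mat X *\<^sub>v u)) = X *\<^sub>v \<theta> + X *\<^sub>v (B *\<^sub>v (transpose_mat X *\<^sub>v u))"
      by (rule mult_add_distrib_mat_vec[OF X(1) t BXTu])
    hence e: "X *\<^sub>v \<theta> + u - X *\<^sub>v theta_LS X (X *\<^sub>v \<theta> + u) = e"
      unfolding LS[OF t u] e_def using X(1) t u BXTu by (intro eq_vecI) auto
    have "scalar_prod e e = (\<Sum>a<n - k. (scalar_prod (V a) u)\<^sup>2)"
      unfolding e_def using residual_sum_of_squares[OF X(1) B _ V u] kn by simp
    also have "\<dots> = (\<Sum>a<n - k. (\<Sum>j<n. V a $ j * u $ j)\<^sup>2)"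
      using u by (simp add: scalar_prod_def lessThan_atLeast0)
    finally have ee: "scalar_prod e e = (\<Sum>a<n - k. (\<Sum>j<n. V a $ j * u $ j)\<^sup>2)" .
    show "(sigma_hat X (X *\<^sub>v \<theta> + u))\<^sup>2 = (\<Sum>a<n - k. (\<Sum>j<n. V a $ j * u $ j)\<^sup>2) / real (n - k)"
      unfolding sigma_hat_def e ee using X(1) by (simp add: sum_nonneg)
  qed
qed

section \<open>The thresholding map\<close>

text \<open>
  The amount by which adaptive soft thresholding with squared threshold \<open>q\<close> moves \<open>L\<close> towards 0: all of
  \<open>L\<close> up to the threshold \<open>sqrt q\<close>, and \<open>q / L\<close> beyond it. For \<open>L = 0\<close> the quotient is 0 by convention
  and the leading factor gives the value 0.
\<close>

definition shrink :: "real \<Rightarrow> real \<Rightarrow> real" where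
  "shrink L q = L * min 1 (q / L\<^sup>2)"

lemma measurable_shrink [measurable (raw)]:
  "f \<in> borel_measurable M \<Longrightarrow> g \<in> borel_measurable M \<Longrightarrow> (\<lambda>x. shrink (f x) (g x)) \<in> borel_measurable M"
  unfolding shrink_def
  by (intro borel_measurable_times borel_measurable_min borel_measurable_divide
      borel_measurable_power borel_measurable_const)

lemma shrink_minus: "shrink (- L) q = - shrink L q"
  by (simp add: shrink_def)

lemma shrink_pos: "0 < L \<Longrightarrow> shrink L q = min L (q / L)"
  by (simp add: shrink_def min_def power2_eq_square field_simps)

lemma shrink_0 [simp]: "shrink 0 q = 0"
  by (simp add: shrink_def)

lemma abs_shrink_le: "0 \<le> q \<Longrightarrow> L \<noteq> 0 \<Longrightarrow> \<bar>shrink L q\<bar> \<le> q / \<bar>L\<bar>"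
proof (cases "0 < L")
  case True
  assume "0 \<le> q" thus ?thesis using True by (simp add: shrink_pos min_def)
next
  case False
  assume "0 \<le> q" "L \<noteq> 0"
  with False have "0 < - L" by simp
  thus ?thesis using \<open>0 \<le> q\<close> shrink_minus[of "-L" q] by (simp add: shrink_pos min_def)
qed

lemma shrink_1: "shrink L 1 = (if \<bar>L\<bar> \<le> 1 then L else 1 / L)"
proof -
  have "1 \<le> 1 / L\<^sup>2 \<longleftrightarrow> \<bar>L\<bar> \<le> 1" if "L \<noteq> 0"
    using that by (simp add: pos_le_divide_eq abs_square_le_1)
  thus ?thesis by (cases "L = 0") (auto simp: shrink_def min_def power2_eq_square)
qed

text \<open>
  On the positive half-line \<open>shrink\<close> has slope 1 below \<open>sqrt q\<close> and slope \<open>- q / L\<^sup>2\<close>, of absolute value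
  at most 1, above it. When \<open>a\<close> and \<open>b\<close> lie on different sides of the threshold, the bound is
  \<open>2 a b \<le> a\<^sup>2 + b\<^sup>2 \<le> q + b\<^sup>2\<close>.
\<close>

lemma shrink_lipschitz_pos:
  assumes "0 \<le> q" "0 < a" "a \<le> b"
  shows "\<bar>shrink a q - shrink b q\<bar> \<le> b - a"
proof -
  have b: "0 < b" using assms by simp
  have 1: "q / b \<le> q / a" using assms by (simp add: frac_le)
  consider "q / b \<le> b" "q / a \<le> a" | "q / b \<le> b" "a < q / a" | "b < q / b" by linarith
  thus ?thesis
  proof cases
    case 1
    have "q / a - q / b = (q / a) / b * (b - a)" using assms b by (simp add: field_simps)
    also have "\<dots> \<le> 1 * (b - a)"
    proof (intro mult_right_mono)
      have "q / a \<le> b" using 1 assms by simp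
      thus "q / a / b \<le> 1" using b by (subst pos_divide_le_eq) simp_all
    qed (use assms in simp)
    finally show ?thesis using 1 \<open>q / b \<le> q / a\<close> assms b by (simp add: shrink_pos min_def)
  next
    case 2
    have "a\<^sup>2 \<le> q" using 2 assms by (simp add: pos_less_divide_eq power2_eq_square)
    hence "2 * a * b \<le> b\<^sup>2 + q" using sum_squares_bound[of a b] by simp
    hence "2 * a \<le> b + q / b" using b by (simp add: field_simps power2_eq_square)
    thus ?thesis using 2 assms b by (simp add: shrink_pos min_def abs_le_iff)
  next
    case 3
    have "b * b < q" using 3 b by (simp add: pos_less_divide_eq)
    moreover have "a * a \<le> b * b" using assms by (intro mult_mono) auto
    ultimately have "a \<le> q / a" using assms by (simp add: pos_le_divide_eq)
    thus ?thesis using 3 assms b by (simp add: shrink_pos min_def)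
  qed
qed

text \<open>
  Since \<open>shrink\<close> is odd in \<open>L\<close> and moves no point past 0, the bound on the positive half-line gives it
  for arguments of the same sign, and for opposite signs the sizes simply add up.
\<close>

lemma shrink_lipschitz:
  assumes "0 \<le> q"
  shows "\<bar>shrink a q - shrink b q\<bar> \<le> \<bar>a - b\<bar>"
proof -
  have size: "0 \<le> shrink x q \<and> shrink x q \<le> x" if "0 \<le> x" for x
    using that assms by (cases "x = 0") (auto simp: shrink_pos)
  have pos: "\<bar>shrink x q - shrink y q\<bar> \<le> \<bar>x - y\<bar>" if "0 \<le> x" "0 \<le> y" for x y
  proof -
    have *: "\<bar>shrink x q - shrink y q\<bar> \<le> y - x" if "0 \<le> x" "x \<le> y" for x y
      using that size[of y] shrink_lipschitz_pos[OF assms, of x y] by (cases "x = 0") auto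
    show ?thesis using *[of x y] *[of y x] that by (cases "x \<le> y") auto
  qed
  consider "0 \<le> a" "0 \<le> b" | "a \<le> 0" "b \<le> 0" | "0 \<le> a" "b \<le> 0" | "a \<le> 0" "0 \<le> b" by linarith
  thus ?thesis
    using pos[of a b] pos[of "-a" "-b"] size[of a] size[of b] size[of "-a"] size[of "-b"]
    by cases (auto simp: shrink_minus)
qed

lemma shrink_lipschitz_right: "\<bar>shrink z p - shrink z q\<bar> \<le> \<bar>p - q\<bar> / \<bar>z\<bar>"
proof (cases "z = 0")
  case False
  have "shrink z p - shrink z q = z * (min 1 (p / z\<^sup>2) - min 1 (q / z\<^sup>2))"
    by (simp add: shrink_def algebra_simps)
  hence "\<bar>shrink z p - shrink z q\<bar> = \<bar>z\<bar> * \<bar>min 1 (p / z\<^sup>2) - min 1 (q / z\<^sup>2)\<bar>"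
    by (simp add: abs_mult)
  also have "\<dots> \<le> \<bar>z\<bar> * \<bar>p / z\<^sup>2 - q / z\<^sup>2\<bar>"
    by (intro mult_left_mono) auto
  also have "\<dots> = \<bar>p - q\<bar> / \<bar>z\<bar>"
    using False by (simp add: diff_divide_distrib[symmetric] power2_eq_square field_simps abs_mult)
  finally show ?thesis .
qed simp

lemma soft_threshold_eq: "L * max 0 (1 - q / L\<^sup>2) = L - shrink L q"
  by (simp add: shrink_def max_def min_def algebra_simps)

section \<open>The limit law for fixed degrees of freedom\<close>

definition limit_law :: "nat \<Rightarrow> real \<Rightarrow> real measure" where
  "limit_law m z = distr (chi_square m) borel (\<lambda>c. - shrink z (c / real m))"

lemma measurable_limit_map [measurable]:
  "(\<lambda>c. - shrink z (c / real m)) \<in> borel_measurable (chi_square m)"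
  by (intro borel_measurable_uminus measurable_shrink) measurable

lemma real_distribution_limit_law: "real_distribution (limit_law m z)"
proof -
  interpret real_distribution "chi_square m" by (rule real_distribution_chi_square)
  show ?thesis unfolding limit_law_def by (rule real_distribution_distr) measurable
qed

lemma minus_shrink_le_iff_pos:
  assumes "0 < z" "0 < m" "0 \<le> c"
  shows "- shrink z (c / real m) \<le> x \<longleftrightarrow> 0 \<le> x \<or> (- z \<le> x \<and> real m * \<bar>x * z\<bar> \<le> c)"
proof (cases "0 \<le> x")
  case True
  have "0 \<le> shrink z (c / real m)" using assms by (simp add: shrink_pos)
  thus ?thesis using True by linarith
next
  case False
  have "- shrink z (c / real m) \<le> x \<longleftrightarrow> - x \<le> z \<and> - x \<le> c / real m / z"
    using assms by (auto simp: shrink_pos min_def)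
  also have "- x \<le> c / real m / z \<longleftrightarrow> real m * \<bar>x * z\<bar> \<le> c"
    using assms False by (simp add: pos_le_divide_eq abs_mult mult_ac)
  finally show ?thesis using False by auto
qed

lemma minus_shrink_le_iff_neg:
  assumes "z < 0" "0 < m" "0 \<le> c"
  shows "- shrink z (c / real m) \<le> x \<longleftrightarrow> - z \<le> x \<or> (0 \<le> x \<and> c \<le> real m * \<bar>x * z\<bar>)"
proof -
  have eq: "- shrink z (c / real m) = min (- z) (c / real m / (- z))"
    using assms shrink_minus[of z] shrink_pos[of "- z" "c / real m"] by simp
  show ?thesis
  proof (cases "0 \<le> x")
    case True
    have "c / real m / (- z) \<le> x \<longleftrightarrow> c \<le> real m * \<bar>x * z\<bar>"
    proof -
      have "\<bar>x * z\<bar> = x * (- z)" using assms True by (simp add: abs_mult)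
      moreover have "c / real m / (- z) \<le> x \<longleftrightarrow> c / real m \<le> x * (- z)"
        using assms by (intro pos_divide_le_eq) simp
      moreover have "c / real m \<le> x * (- z) \<longleftrightarrow> c \<le> x * (- z) * real m"
        using assms by (intro pos_divide_le_eq) simp
      ultimately show ?thesis by (simp only: mult.commute)
    qed
    thus ?thesis unfolding eq using True by (auto simp: min_le_iff_disj)
  next
    case False
    have "0 \<le> c / real m / (- z)" using assms by (intro divide_nonneg_pos) auto
    thus ?thesis unfolding eq using False assms by (auto simp: min_le_iff_disj)
  qed
qed

lemma cdf_limit_law:
  "cdf (limit_law m z) x = measure (chi_square m) {c. - shrink z (c / real m) \<le> x}"
  unfolding limit_law_def cdf_def
  by (subst measure_distr) (auto simp: vimage_def)

text \<open>
  The weak inequality \<open>m * \<bar>x * z\<bar> \<le> c\<close> that describes the event becomes strict because the chi-square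
  law has no atoms. For \<open>z = 0\<close> the law is the point mass at 0 and the interval \<open>{-z..<0}\<close> is empty.
\<close>

lemma cdf_limit_law_nonneg:
  assumes m: "0 < m" and z: "0 \<le> z"
  shows "cdf (limit_law m z) x
    = measure (chi_square m) {real m * \<bar>x * z\<bar><..} * indicator {-z..<0} x + indicator {0..} x"
proof (cases "z = 0")
  case True
  interpret real_distribution "chi_square m" by (rule real_distribution_chi_square)
  have "prob UNIV = 1" using prob_space by simp
  with True show ?thesis by (simp add: cdf_limit_law indicator_def)
next
  case False
  interpret real_distribution "chi_square m" by (rule real_distribution_chi_square)
  have iff: "AE c in chi_square m. - shrink z (c / real m) \<le> x \<longleftrightarrow>
      0 \<le> x \<or> (- z \<le> x \<and> real m * \<bar>x * z\<bar> \<le> c)"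
    using AE_chi_square_nonneg[of m]
    by eventually_elim (use minus_shrink_le_iff_pos[of z m] z False m in auto)
  have "cdf (limit_law m z) x = prob {c. 0 \<le> x \<or> (- z \<le> x \<and> real m * \<bar>x * z\<bar> \<le> c)}"
    unfolding cdf_limit_law by (rule finite_measure_eq_AE) (use iff in auto)
  also have "\<dots> = prob {real m * \<bar>x * z\<bar><..} * indicator {-z..<0} x + indicator {0..} x"
    using measure_chi_square_atLeast[OF m, of "real m * \<bar>x * z\<bar>"] prob_space
    by (auto simp: indicator_def atLeast_def)
  finally show ?thesis .
qed

lemma cdf_limit_law_neg:
  assumes m: "0 < m" and z: "z < 0"
  shows "cdf (limit_law m z) x
    = measure (chi_square m) {..real m * \<bar>x * z\<bar>} * indicator {0..<-z} x + indicator {-z..} x"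
proof -
  interpret real_distribution "chi_square m" by (rule real_distribution_chi_square)
  have iff: "AE c in chi_square m. - shrink z (c / real m) \<le> x \<longleftrightarrow>
      - z \<le> x \<or> (0 \<le> x \<and> c \<le> real m * \<bar>x * z\<bar>)"
    using AE_chi_square_nonneg[of m]
    by eventually_elim (use minus_shrink_le_iff_neg[of z m] z m in auto)
  have "cdf (limit_law m z) x = prob {c. - z \<le> x \<or> (0 \<le> x \<and> c \<le> real m * \<bar>x * z\<bar>)}"
    unfolding cdf_limit_law by (rule finite_measure_eq_AE) (use iff in auto)
  also have "\<dots> = prob {..real m * \<bar>x * z\<bar>} * indicator {0..<-z} x + indicator {-z..} x"
    using prob_space z by (auto simp: indicator_def atMost_def)
  finally show ?thesis .
qed

lemma shrink_eq_self_iff: "z \<noteq> 0 \<Longrightarrow> shrink z q = z \<longleftrightarrow> z\<^sup>2 \<le> q"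
  using pos_le_divide_eq[of "z\<^sup>2" 1 q] by (auto simp: shrink_def min_def)

text \<open>
  The atom collects the event that thresholding returns 0, that is \<open>shrink z q = z\<close>.
\<close>

lemma limit_law_atom:
  assumes m: "0 < m"
  shows "measure (limit_law m z) {-z} = measure (chi_square m) {real m * z\<^sup>2<..}"
proof -
  interpret real_distribution "chi_square m" by (rule real_distribution_chi_square)
  have atom: "measure (limit_law m z) {-z} = prob {c. shrink z (c / real m) = z}"
    unfolding limit_law_def by (subst measure_distr) (auto simp: vimage_def)
  show ?thesis
  proof (cases "z = 0")
    case True
    have "AE c in chi_square m. c \<notin> {..0}"
      using emeasure_chi_square_atMost_0[OF m] by (intro AE_not_in) auto
    hence "prob UNIV = prob {0<..}"
      by (intro finite_measure_eq_AE) (auto elim!: eventually_mono)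
    thus ?thesis using True atom by simp
  next
    case False
    have "{c. shrink z (c / real m) = z} = {real m * z\<^sup>2..}"
      using m False by (auto simp: shrink_eq_self_iff pos_le_divide_eq mult_ac)
    thus ?thesis using atom measure_chi_square_atLeast[OF m] by simp
  qed
qed

lemma limit_law_0: "limit_law m 0 = return borel 0"
proof -
  interpret real_distribution "chi_square m" by (rule real_distribution_chi_square)
  show ?thesis
    unfolding limit_law_def shrink_0 by (subst distr_const) (auto simp: emeasure_space_1)
qed

text \<open>
  Off the atom, \<open>- shrink z (c / m)\<close> is the linear function \<open>- c / (m * z)\<close> of the chi-square variable.
\<close>

lemma absolutely_continuous_limit_law_off_atom:
  assumes m: "0 < m"
  shows "absolutely_continuous lborel (density (limit_law m z) (indicator (- {-z})))"
  unfolding absolutely_continuous_def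
proof
  fix N :: "real set" assume N: "N \<in> null_sets lborel"
  hence [measurable]: "N \<in> sets borel" by auto
  interpret real_distribution "chi_square m" by (rule real_distribution_chi_square)
  have sets: "sets (limit_law m z) = sets borel" by (simp add: limit_law_def)
  have "emeasure (density (limit_law m z) (indicator (- {-z}))) N = emeasure (limit_law m z) (N - {-z})"
    using sets by (subst emeasure_density) (auto simp: indicator_inter_arith[symmetric] Diff_eq Int_commute)
  also have "\<dots> = emeasure (chi_square m) {c. - shrink z (c / real m) \<in> N - {-z}}"
    unfolding limit_law_def by (subst emeasure_distr) (auto simp: vimage_def)
  also have "\<dots> = 0"
  proof (cases "z = 0")
    case False
    let ?S = "{c. - (c / real m / z) \<in> N}"
    have "?S \<in> null_sets lborel"
    proof (rule null_set_lborel_transfer[OF N, of "\<lambda>y. - y * z * real m" UNIV], goal_cases)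
      case 1 show ?case
        by (intro differentiable_on_mult differentiable_on_minus differentiable_on_id[unfolded id_def] differentiable_on_const)
    next
      case 2 show ?case by measurable
    next
      case 3 show ?case
      proof
        fix c assume "c \<in> ?S"
        thus "c \<in> (\<lambda>y. - y * z * real m) ` (N \<inter> UNIV)"
          by (intro image_eqI[where x = "- (c / real m / z)"]) (use False m in auto)
      qed
    qed
    hence null: "?S \<in> null_sets (chi_square m)"
      using absolutely_continuous_chi_square[OF m] by (auto simp: absolutely_continuous_def)
    have shr: "shrink z q = z \<or> shrink z q = q / z" for q
      using False by (auto simp: shrink_def min_def power2_eq_square)
    have sub: "{c. - shrink z (c / real m) \<in> N - {-z}} \<subseteq> ?S"
    proof
      fix c assume "c \<in> {c. - shrink z (c / real m) \<in> N - {-z}}"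
      thus "c \<in> ?S" using shr[of "c / real m"] by auto
    qed
    show ?thesis
      by (rule null_setsD1, rule null_sets_subset[OF null _ sub]) measurable
  qed simp
  finally show "N \<in> null_sets (density (limit_law m z) (indicator (- {-z})))"
    using sets by (auto simp: null_sets_def)
qed

section \<open>Canonical form of the scaled estimation error\<close>

text \<open>
  Passing to the standard Gaussian product measure lets all expectations be computed on one fixed
  space, whatever probability space carries the errors.
\<close>

lemma normal_errors_standardized:
  assumes "prob_space M" "normal_errors M n \<sigma> u" "0 < \<sigma>" "0 < n"
  defines "Z \<equiv> \<lambda>\<omega>. \<lambda>j\<in>{..<n}. u \<omega> $ j / \<sigma>"
  shows "Z \<in> measurable M (std_gaussian n)" "distr M (std_gaussian n) Z = std_gaussian n"
proof -
  interpret prob_space M by fact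
  have ind: "indep_vars (\<lambda>_. borel) (\<lambda>j \<omega>. u \<omega> $ j) {..<n}"
    and dist: "\<And>j. j < n \<Longrightarrow> distributed M lborel (\<lambda>\<omega>. u \<omega> $ j) (normal_density 0 \<sigma>)"
    using assms(2) by (auto simp: normal_errors_def)
  have ind': "indep_vars (\<lambda>_. borel) (\<lambda>j \<omega>. u \<omega> $ j / \<sigma>) {..<n}"
    by (rule indep_vars_compose2[OF ind, of "\<lambda>_ x. x / \<sigma>"]) simp
  have std: "distributed M lborel (\<lambda>\<omega>. u \<omega> $ j / \<sigma>) std_normal_density" if "j < n" for j
    using dist[OF that] normal_standard_normal_convert[OF assms(3), of "\<lambda>\<omega>. u \<omega> $ j" 0] by simp
  have rv: "random_variable borel (\<lambda>\<omega>. u \<omega> $ j / \<sigma>)" if "j < n" for j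
    using distributed_measurable[OF std[OF that]] by simp
  have law: "distr M borel (\<lambda>\<omega>. u \<omega> $ j / \<sigma>) = std_normal_distribution" if "j < n" for j
    using distributed_distr_eq_density[OF std[OF that]] by (simp cong: distr_cong)
  have sets_eq: "sets (Pi\<^sub>M {..<n} (\<lambda>_. borel :: real measure)) = sets (std_gaussian n)"
    by (rule sets_PiM_cong) simp_all
  have "Z \<in> measurable M (Pi\<^sub>M {..<n} (\<lambda>_. borel))"
    unfolding Z_def by (rule measurable_restrict) (use rv in simp)
  thus "Z \<in> measurable M (std_gaussian n)"
    using measurable_cong_sets[OF refl sets_eq] by blast
  have "distr M (std_gaussian n) Z = distr M (Pi\<^sub>M {..<n} (\<lambda>_. borel)) Z"
    by (rule distr_cong) (simp_all add: sets_eq)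
  also have "\<dots> = (\<Pi>\<^sub>M j\<in>{..<n}. distr M borel (\<lambda>\<omega>. u \<omega> $ j / \<sigma>))"
    unfolding Z_def
    using indep_vars_iff_distr_eq_PiM'[of "{..<n}" "\<lambda>j \<omega>. u \<omega> $ j / \<sigma>" "\<lambda>_. borel"] ind' rv assms(4)
    by (auto simp: lessThan_empty_iff)
  also have "\<dots> = std_gaussian n"
    by (rule PiM_cong) (simp_all add: law)
  finally show "distr M (std_gaussian n) Z = std_gaussian n" .
qed

text \<open>
  Every model, whatever its design matrix, reduces to two scalar random variables: the scaled error \<open>W\<close>
  of the least squares component and the variance ratio \<open>q\<close>. All nuisance quantities cancel except
  \<open>n * \<eta>\<^sup>2\<close>, the degrees of freedom, and the scaled parameter.
\<close>

lemma linear_regression_canonical_form: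
  assumes lr: "linear_regression M n k X \<theta> \<sigma> u Y" and i: "i < k" and eta: "0 < \<eta> i"
  obtains W q :: "'a \<Rightarrow> real" where
    "W \<in> borel_measurable M" "q \<in> borel_measurable M" "\<And>\<omega>. 0 \<le> q \<omega>"
    "integrable M (\<lambda>\<omega>. (W \<omega>)\<^sup>2)" "(LINT \<omega>|M. (W \<omega>)\<^sup>2) = 1 / (real n * (\<eta> i)\<^sup>2)"
    "distr M borel (\<lambda>\<omega>. real (n - k) * q \<omega>) = chi_square (n - k)"
    "\<And>\<omega>. \<omega> \<in> space M \<Longrightarrow>
       inverse \<sigma> * inverse (xi X i * \<eta> i) * (theta_AS X \<eta> (Y \<omega>) i - \<theta> $ i)
         = W \<omega> - shrink (\<theta> $ i / (\<sigma> * xi X i * \<eta> i) + W \<omega>) (q \<omega>)"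
proof -
  have M: "prob_space M" and kn: "k < n" and X: "X \<in> carrier_mat n k" "vec_space.rank n X = k"
    and t: "\<theta> \<in> carrier_vec k" and s: "0 < \<sigma>" and ne: "normal_errors M n \<sigma> u"
    and Y: "\<And>\<omega>. \<omega> \<in> space M \<Longrightarrow> Y \<omega> = X *\<^sub>v \<theta> + u \<omega>"
    using lr by (auto simp: linear_regression_def)
  have u: "u \<omega> \<in> carrier_vec n" if "\<omega> \<in> space M" for \<omega> using ne that by (auto simp: normal_errors_def)
  obtain c V where xi: "0 < xi X i" and c: "(\<Sum>j<n. (c j)\<^sup>2) = (xi X i)\<^sup>2 / real n"
    and V: "\<And>a b. a < n - k \<Longrightarrow> b < n - k \<Longrightarrow> (\<Sum>j<n. V a j * V b j) = (if a = b then 1 else 0)"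
    and LS: "\<And>\<theta> u. \<theta> \<in> carrier_vec k \<Longrightarrow> u \<in> carrier_vec n \<Longrightarrow>
       theta_LS X (X *\<^sub>v \<theta> + u) $ i = \<theta> $ i + (\<Sum>j<n. c j * u $ j)"
    and SH: "\<And>\<theta> u. \<theta> \<in> carrier_vec k \<Longrightarrow> u \<in> carrier_vec n \<Longrightarrow>
       (sigma_hat X (X *\<^sub>v \<theta> + u))\<^sup>2 = (\<Sum>a<n - k. (\<Sum>j<n. V a j * u $ j)\<^sup>2) / real (n - k)"
  proof (rule least_squares_canonical_form[OF X kn i], goal_cases)
    case (1 c V)
    from 1(2-6) show ?case by (rule 1(1))
  qed
  define Z where "Z \<omega> = (\<lambda>j\<in>{..<n}. u \<omega> $ j / \<sigma>)" for \<omega>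
  have Z: "Z \<in> measurable M (std_gaussian n)" and law: "distr M (std_gaussian n) Z = std_gaussian n"
    using normal_errors_standardized[OF M ne s] kn unfolding Z_def[abs_def] by auto
  let ?d = "xi X i * \<eta> i"
  have d: "0 < ?d" using xi eta by simp
  define w where "w z = (\<Sum>j<n. (c j / ?d) * z j)" for z :: "nat \<Rightarrow> real"
  define p where "p z = (\<Sum>a<n - k. (\<Sum>j<n. V a j * z j)\<^sup>2) / real (n - k)" for z
  have w [measurable]: "w \<in> borel_measurable (std_gaussian n)"
    unfolding w_def by measurable
  have p [measurable]: "p \<in> borel_measurable (std_gaussian n)"
    unfolding p_def by (intro borel_measurable_divide borel_measurable_sum borel_measurable_power) measurable
  show ?thesis
  proof (rule that[of "\<lambda>\<omega>. w (Z \<omega>)" "\<lambda>\<omega>. p (Z \<omega>)"])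
    show "(\<lambda>\<omega>. w (Z \<omega>)) \<in> borel_measurable M" by (rule measurable_compose[OF Z w])
    show "(\<lambda>\<omega>. p (Z \<omega>)) \<in> borel_measurable M" by (rule measurable_compose[OF Z p])
    show "0 \<le> p (Z \<omega>)" for \<omega> by (simp add: p_def sum_nonneg)
    have w2: "(\<lambda>z. (w z)\<^sup>2) \<in> borel_measurable (std_gaussian n)" by measurable
    have "integrable (distr M (std_gaussian n) Z) (\<lambda>z. (w z)\<^sup>2)"
      unfolding law w_def by (rule integrable_square_linear_comb)
    thus "integrable M (\<lambda>\<omega>. (w (Z \<omega>))\<^sup>2)"
      using integrable_distr_eq[OF Z w2] by simp
    have "(LINT \<omega>|M. (w (Z \<omega>))\<^sup>2) = (LINT z|std_gaussian n. (w z)\<^sup>2)"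
      using integral_distr[OF Z w2] by (simp add: law)
    also have "\<dots> = (\<Sum>j<n. (c j / ?d)\<^sup>2)"
      unfolding w_def by (rule integral_square_linear_comb)
    also have "\<dots> = 1 / (real n * (\<eta> i)\<^sup>2)"
      using xi by (simp add: power_divide sum_divide_distrib[symmetric] c power_mult_distrib)
    finally show "(LINT \<omega>|M. (w (Z \<omega>))\<^sup>2) = 1 / (real n * (\<eta> i)\<^sup>2)" .
    have mp: "(\<lambda>z. real (n - k) * p z) \<in> borel_measurable (std_gaussian n)" by measurable
    have "distr M borel (\<lambda>\<omega>. real (n - k) * p (Z \<omega>)) = distr (std_gaussian n) borel (\<lambda>z. real (n - k) * p z)"
      using distr_distr[OF mp Z] by (simp add: law comp_def)
    also have "\<dots> = chi_square (n - k)"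
      using sum_squares_orthonormal_eq_chi_square[OF V] kn by (simp add: p_def)
    finally show "distr M borel (\<lambda>\<omega>. real (n - k) * p (Z \<omega>)) = chi_square (n - k)" .
    fix \<omega> assume \<omega>: "\<omega> \<in> space M"
    have uZ: "u \<omega> $ j = \<sigma> * Z \<omega> j" if "j < n" for j using that s by (simp add: Z_def)
    have L: "theta_LS X (Y \<omega>) $ i = \<sigma> * ?d * (\<theta> $ i / (\<sigma> * xi X i * \<eta> i) + w (Z \<omega>))"
    proof -
      have "(\<Sum>j<n. c j * u \<omega> $ j) = \<sigma> * ?d * w (Z \<omega>)"
        using xi eta by (simp add: w_def sum_distrib_left uZ mult_ac)
      thus ?thesis using LS[OF t u[OF \<omega>]] Y[OF \<omega>] s xi eta by (simp add: field_simps)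
    qed
    have S: "(sigma_hat X (Y \<omega>))\<^sup>2 = \<sigma>\<^sup>2 * p (Z \<omega>)"
    proof -
      have lin: "(\<Sum>j<n. V a j * u \<omega> $ j) = \<sigma> * (\<Sum>j<n. V a j * Z \<omega> j)" for a
        by (simp add: sum_distrib_left uZ mult_ac)
      have "(\<Sum>a<n - k. (\<Sum>j<n. V a j * u \<omega> $ j)\<^sup>2)
          = \<sigma>\<^sup>2 * (\<Sum>a<n - k. (\<Sum>j<n. V a j * Z \<omega> j)\<^sup>2)"
        unfolding lin power_mult_distrib sum_distrib_left[symmetric] ..
      thus ?thesis
        using SH[OF t u[OF \<omega>]] Y[OF \<omega>] by (simp add: p_def)
    qed
    let ?L = "\<theta> $ i / (\<sigma> * xi X i * \<eta> i) + w (Z \<omega>)"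
    have quot: "\<sigma>\<^sup>2 * p (Z \<omega>) * (xi X i)\<^sup>2 * (\<eta> i)\<^sup>2 / (\<sigma> * ?d * ?L)\<^sup>2 = p (Z \<omega>) / ?L\<^sup>2"
      using s xi eta by (simp add: power_mult_distrib)
    have "theta_AS X \<eta> (Y \<omega>) i = \<sigma> * ?d * (?L * max 0 (1 - p (Z \<omega>) / ?L\<^sup>2))"
      unfolding theta_AS_def S L quot by simp
    also have "\<dots> = \<sigma> * ?d * (?L - shrink ?L (p (Z \<omega>)))"
      by (simp only: soft_threshold_eq)
    finally have eq: "theta_AS X \<eta> (Y \<omega>) i = \<sigma> * ?d * (?L - shrink ?L (p (Z \<omega>)))" .
    show "inverse \<sigma> * inverse ?d * (theta_AS X \<eta> (Y \<omega>) i - \<theta> $ i)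
         = w (Z \<omega>) - shrink ?L (p (Z \<omega>))"
    proof -
      have cancel: "inverse \<sigma> * inverse ?d * (\<sigma> * ?d * a - \<sigma> * ?d * b) = a - b" for a b
        using s xi eta by (simp add: field_simps)
      have "\<theta> $ i = \<sigma> * ?d * (\<theta> $ i / (\<sigma> * xi X i * \<eta> i))"
        using s xi eta by simp
      hence "inverse \<sigma> * inverse ?d * (theta_AS X \<eta> (Y \<omega>) i - \<theta> $ i)
          = ?L - shrink ?L (p (Z \<omega>)) - \<theta> $ i / (\<sigma> * xi X i * \<eta> i)"
        using cancel[of "?L - shrink ?L (p (Z \<omega>))" "\<theta> $ i / (\<sigma> * xi X i * \<eta> i)"] eq
        by presburger
      thus ?thesis by simp
    qed
  qed
qed

section \<open>Convergence in probability and weak convergence\<close>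

definition vanishes_in_prob :: "(nat \<Rightarrow> 'a measure) \<Rightarrow> (nat \<Rightarrow> 'a \<Rightarrow> real) \<Rightarrow> bool" where
  "vanishes_in_prob M f \<longleftrightarrow>
     (\<forall>\<epsilon>>0. (\<lambda>n. measure (M n) {\<omega> \<in> space (M n). \<epsilon> < \<bar>f n \<omega>\<bar>}) \<longlonglongrightarrow> 0)"

lemma vanishes_in_probI_first_moment:
  assumes "eventually (\<lambda>n. prob_space (M n) \<and> integrable (M n) (f n)) sequentially"
    and "(\<lambda>n. LINT \<omega>|M n. \<bar>f n \<omega>\<bar>) \<longlonglongrightarrow> 0"
  shows "vanishes_in_prob M f"
  unfolding vanishes_in_prob_def
proof (intro allI impI)
  fix \<epsilon> :: real assume e: "0 < \<epsilon>"
  show "(\<lambda>n. measure (M n) {\<omega> \<in> space (M n). \<epsilon> < \<bar>f n \<omega>\<bar>}) \<longlonglongrightarrow> 0"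
  proof (rule tendsto_sandwich[OF _ _ tendsto_const])
    show "(\<lambda>n. (LINT \<omega>|M n. \<bar>f n \<omega>\<bar>) / \<epsilon>) \<longlonglongrightarrow> 0"
      using tendsto_divide[OF assms(2) tendsto_const, of \<epsilon>] e by simp
    show "\<forall>\<^sub>F n in sequentially. measure (M n) {\<omega> \<in> space (M n). \<epsilon> < \<bar>f n \<omega>\<bar>}
        \<le> (LINT \<omega>|M n. \<bar>f n \<omega>\<bar>) / \<epsilon>"
      using assms(1)
    proof eventually_elim
      case (elim n)
      then interpret prob_space "M n" by simp
      have f: "integrable (M n) (f n)" using elim by simp
      hence [measurable]: "f n \<in> borel_measurable (M n)" by simp
      have "measure (M n) {\<omega> \<in> space (M n). \<epsilon> < \<bar>f n \<omega>\<bar>}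
          \<le> measure (M n) {\<omega> \<in> space (M n). \<epsilon> \<le> \<bar>f n \<omega>\<bar>}"
        by (intro finite_measure_mono) auto
      also have "\<dots> \<le> (LINT \<omega>|M n. \<bar>f n \<omega>\<bar>) / \<epsilon>"
        by (rule integral_Markov_inequality_measure[where A = "{}"]) (use f e in auto)
      finally show ?case .
    qed
  qed simp
qed

lemma vanishes_in_probI_second_moment:
  assumes "eventually (\<lambda>n. prob_space (M n) \<and> integrable (M n) (\<lambda>\<omega>. (f n \<omega>)\<^sup>2)) sequentially"
    and "(\<lambda>n. LINT \<omega>|M n. (f n \<omega>)\<^sup>2) \<longlonglongrightarrow> 0"
  shows "vanishes_in_prob M f"
  unfolding vanishes_in_prob_def
proof (intro allI impI)
  fix \<epsilon> :: real assume e: "0 < \<epsilon>"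
  have "vanishes_in_prob M (\<lambda>n \<omega>. (f n \<omega>)\<^sup>2)"
    by (rule vanishes_in_probI_first_moment) (use assms in simp_all)
  hence "(\<lambda>n. measure (M n) {\<omega> \<in> space (M n). \<epsilon>\<^sup>2 < \<bar>(f n \<omega>)\<^sup>2\<bar>}) \<longlonglongrightarrow> 0"
    using e by (simp add: vanishes_in_prob_def del: abs_power2)
  moreover have "\<epsilon>\<^sup>2 < \<bar>x\<^sup>2\<bar> \<longleftrightarrow> \<epsilon> < \<bar>x\<bar>" for x
    using e abs_le_square_iff[of x \<epsilon>] by (simp add: not_le[symmetric])
  ultimately show "(\<lambda>n. measure (M n) {\<omega> \<in> space (M n). \<epsilon> < \<bar>f n \<omega>\<bar>}) \<longlonglongrightarrow> 0"
    by simp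
qed

text \<open>
  A form of the union bound for sums, shaped after the error bounds of the theorem: twice the least
  squares error, plus a term from the variance ratio, plus a deterministic null sequence.
\<close>

lemma vanishes_in_prob_dominated:
  assumes prob: "eventually (\<lambda>n. prob_space (M n)) sequentially"
    and meas: "eventually (\<lambda>n. f n \<in> borel_measurable (M n) \<and> g n \<in> borel_measurable (M n)) sequentially"
    and f: "vanishes_in_prob M f" and g: "vanishes_in_prob M g" and r: "r \<longlonglongrightarrow> 0"
    and le: "eventually (\<lambda>n. \<forall>\<omega>\<in>space (M n). \<bar>R n \<omega>\<bar> \<le> 2 * \<bar>f n \<omega>\<bar> + \<bar>g n \<omega>\<bar> + r n) sequentially"
  shows "vanishes_in_prob M R"
  unfolding vanishes_in_prob_def
proof (intro allI impI)
  fix \<epsilon> :: real assume e: "0 < \<epsilon>"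
  let ?A = "\<lambda>n. {\<omega> \<in> space (M n). \<epsilon> / 6 < \<bar>f n \<omega>\<bar>}"
  let ?B = "\<lambda>n. {\<omega> \<in> space (M n). \<epsilon> / 3 < \<bar>g n \<omega>\<bar>}"
  show "(\<lambda>n. measure (M n) {\<omega> \<in> space (M n). \<epsilon> < \<bar>R n \<omega>\<bar>}) \<longlonglongrightarrow> 0"
  proof (rule tendsto_sandwich[OF _ _ tendsto_const])
    show "(\<lambda>n. measure (M n) (?A n) + measure (M n) (?B n)) \<longlonglongrightarrow> 0"
      using f[unfolded vanishes_in_prob_def, rule_format, of "\<epsilon> / 6"]
        g[unfolded vanishes_in_prob_def, rule_format, of "\<epsilon> / 3"] e
      by (intro tendsto_add_zero) simp_all
    have "eventually (\<lambda>n. r n < \<epsilon> / 3) sequentially"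
      using order_tendstoD(2)[OF r, of "\<epsilon> / 3"] e by simp
    with prob meas le show "\<forall>\<^sub>F n in sequentially. measure (M n) {\<omega> \<in> space (M n). \<epsilon> < \<bar>R n \<omega>\<bar>}
        \<le> measure (M n) (?A n) + measure (M n) (?B n)"
    proof eventually_elim
      case (elim n)
      then interpret prob_space "M n" by simp
      have [measurable]: "f n \<in> borel_measurable (M n)" "g n \<in> borel_measurable (M n)"
        using elim by auto
      have sub: "{\<omega> \<in> space (M n). \<epsilon> < \<bar>R n \<omega>\<bar>} \<subseteq> ?A n \<union> ?B n"
      proof
        fix \<omega> assume "\<omega> \<in> {\<omega> \<in> space (M n). \<epsilon> < \<bar>R n \<omega>\<bar>}"
        hence o: "\<omega> \<in> space (M n)" "\<epsilon> < \<bar>R n \<omega>\<bar>" by auto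
        have "\<bar>R n \<omega>\<bar> \<le> 2 * \<bar>f n \<omega>\<bar> + \<bar>g n \<omega>\<bar> + r n" using elim(3) o(1) by blast
        hence "\<epsilon> / 6 < \<bar>f n \<omega>\<bar> \<or> \<epsilon> / 3 < \<bar>g n \<omega>\<bar>" using o(2) elim(4) by argo
        thus "\<omega> \<in> ?A n \<union> ?B n" using o(1) by auto
      qed
      have "measure (M n) {\<omega> \<in> space (M n). \<epsilon> < \<bar>R n \<omega>\<bar>} \<le> measure (M n) (?A n \<union> ?B n)"
        by (rule finite_measure_mono[OF sub]) measurable
      also have "\<dots> \<le> measure (M n) (?A n) + measure (M n) (?B n)"
        by (rule measure_Un_le) measurable
      finally show ?case .
    qed
  qed simp
qed

text \<open>
  Outside the event that \<open>T n\<close> and \<open>D n\<close> differ by more than \<open>d\<close>, the event \<open>T n \<le> x\<close> lies between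
  \<open>D n \<le> x - d\<close> and \<open>D n \<le> x + d\<close>; continuity of the limit cdf at \<open>x\<close> closes the gap.
\<close>

lemma weak_conv_slutsky:
  assumes \<mu>: "real_distribution \<mu>"
    and prob: "eventually (\<lambda>n. prob_space (M n)) sequentially"
    and meas: "eventually (\<lambda>n. T n \<in> borel_measurable (M n) \<and> D n \<in> borel_measurable (M n)) sequentially"
    and D: "eventually (\<lambda>n. distr (M n) borel (D n) = \<mu>) sequentially"
    and van: "vanishes_in_prob M (\<lambda>n \<omega>. T n \<omega> - D n \<omega>)"
    and H: "eventually (\<lambda>n. H n = cdf (distr (M n) borel (T n))) sequentially"
  shows "weak_conv H (cdf \<mu>)"
  unfolding weak_conv_def
proof (intro allI impI)
  fix x assume cont: "isCont (cdf \<mu>) x"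
  interpret m: real_distribution \<mu> by fact
  show "(\<lambda>n. H n x) \<longlonglongrightarrow> cdf \<mu> x"
  proof (rule tendstoI)
    fix e :: real assume e: "0 < e"
    obtain d where d: "0 < d" "\<And>y. \<bar>y - x\<bar> \<le> d \<Longrightarrow> \<bar>cdf \<mu> y - cdf \<mu> x\<bar> < e / 2"
    proof -
      obtain s where s: "s > 0" "\<And>y. dist y x < s \<Longrightarrow> dist (cdf \<mu> y) (cdf \<mu> x) < e / 2"
        using cont e unfolding continuous_at_eps_delta by (meson half_gt_zero)
      show ?thesis by (rule that[of "s / 2"]) (use s in \<open>auto simp: dist_real_def\<close>)
    qed
    let ?E = "\<lambda>n. {\<omega> \<in> space (M n). d < \<bar>T n \<omega> - D n \<omega>\<bar>}"
    have "(\<lambda>n. measure (M n) (?E n)) \<longlonglongrightarrow> 0"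
      using van d(1) by (simp add: vanishes_in_prob_def)
    from order_tendstoD(2)[OF this, of "e / 2"] e
    have "eventually (\<lambda>n. measure (M n) (?E n) < e / 2) sequentially" by simp
    with prob meas D H show "\<forall>\<^sub>F n in sequentially. dist (H n x) (cdf \<mu> x) < e"
    proof eventually_elim
      case (elim n)
      then interpret prob_space "M n" by simp
      have [measurable]: "T n \<in> borel_measurable (M n)" "D n \<in> borel_measurable (M n)"
        using elim by auto
      have HT: "H n x = prob {\<omega> \<in> space (M n). T n \<omega> \<le> x}"
        unfolding elim(4) cdf_def by (subst measure_distr) (auto intro!: arg_cong[where f = prob])
      have cD: "cdf \<mu> y = prob {\<omega> \<in> space (M n). D n \<omega> \<le> y}" for y
        unfolding elim(3)[symmetric] cdf_def by (subst measure_distr) (auto intro!: arg_cong[where f = prob])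
      have "prob {\<omega> \<in> space (M n). T n \<omega> \<le> x} \<le> prob ({\<omega> \<in> space (M n). D n \<omega> \<le> x + d} \<union> ?E n)"
        by (rule finite_measure_mono) auto
      also have "\<dots> \<le> cdf \<mu> (x + d) + prob (?E n)"
        unfolding cD by (rule measure_Un_le) measurable
      finally have up: "H n x \<le> cdf \<mu> (x + d) + prob (?E n)" by (simp add: HT)
      have "cdf \<mu> (x - d) \<le> prob ({\<omega> \<in> space (M n). T n \<omega> \<le> x} \<union> ?E n)"
        unfolding cD by (rule finite_measure_mono) auto
      also have "\<dots> \<le> H n x + prob (?E n)"
        unfolding HT by (rule measure_Un_le) measurable
      finally have lo: "cdf \<mu> (x - d) \<le> H n x + prob (?E n)" .
      have "\<bar>cdf \<mu> (x + d) - cdf \<mu> x\<bar> < e / 2" "\<bar>cdf \<mu> (x - d) - cdf \<mu> x\<bar> < e / 2"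
        using d(1) d(2)[of "x + d"] d(2)[of "x - d"] by simp_all
      thus ?case
        using up lo elim(5) unfolding dist_real_def abs_less_iff by linarith
    qed
  qed
qed

lemma weak_conv_const:
  assumes "eventually (\<lambda>n. prob_space (M n)) sequentially"
    and "eventually (\<lambda>n. T n \<in> borel_measurable (M n)) sequentially"
    and "vanishes_in_prob M (\<lambda>n \<omega>. T n \<omega> - c)"
    and "eventually (\<lambda>n. H n = cdf (distr (M n) borel (T n))) sequentially"
  shows "weak_conv H (cdf (return borel c))"
proof (rule weak_conv_slutsky[where D = "\<lambda>_ _. c"])
  show "real_distribution (return borel c)"
    unfolding real_distribution_def real_distribution_axioms_def
    by (simp add: prob_space_return)
  show "\<forall>\<^sub>F n in sequentially. distr (M n) borel (\<lambda>_. c) = return borel c"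
    using assms(1) by eventually_elim (simp add: prob_space.distr_const)
  show "\<forall>\<^sub>F n in sequentially. T n \<in> borel_measurable (M n) \<and> (\<lambda>_. c) \<in> borel_measurable (M n)"
    using assms(2) by eventually_elim simp
qed (use assms in simp_all)

section \<open>Asymptotic distribution of the adaptive soft-thresholding estimator\<close>

lemma tendsto_inverse_abs_infinite:
  fixes t :: "nat \<Rightarrow> real"
  assumes "(\<lambda>n. ereal (t n)) \<longlonglongrightarrow> \<zeta>" "\<bar>\<zeta>\<bar> = \<infinity>"
  shows "(\<lambda>n. 1 / \<bar>t n\<bar>) \<longlonglongrightarrow> 0" "eventually (\<lambda>n. t n \<noteq> 0) sequentially"
proof -
  have "(\<lambda>n. \<bar>ereal (t n)\<bar>) \<longlonglongrightarrow> \<bar>\<zeta>\<bar>" by (rule tendsto_abs_ereal) (rule assms)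
  hence "(\<lambda>n. ereal \<bar>t n\<bar>) \<longlonglongrightarrow> \<infinity>" using assms(2) by simp
  hence top: "filterlim (\<lambda>n. \<bar>t n\<bar>) at_top sequentially" by (simp add: tendsto_PInfty_eq_at_top)
  from tendsto_inverse_0_at_top[OF this] show "(\<lambda>n. 1 / \<bar>t n\<bar>) \<longlonglongrightarrow> 0"
    by (simp add: inverse_eq_divide)
  have "eventually (\<lambda>n. 0 < \<bar>t n\<bar>) sequentially"
    using filterlim_at_top_dense[THEN iffD1, OF top] by blast
  thus "eventually (\<lambda>n. t n \<noteq> 0) sequentially" by eventually_elim simp
qed

theorem theorem38:
  fixes N i :: nat
    and k :: "nat \<Rightarrow> nat"
    and X :: "nat \<Rightarrow> real mat"
    and M :: "nat \<Rightarrow> 'a measure"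
    and u Y :: "nat \<Rightarrow> 'a \<Rightarrow> real vec"
    and \<theta> :: "nat \<Rightarrow> real vec"
    and \<sigma> :: "nat \<Rightarrow> real"
    and \<eta> :: "nat \<Rightarrow> nat \<Rightarrow> real"
    and \<zeta> :: ereal
    and H :: "nat \<Rightarrow> real \<Rightarrow> real"
  assumes model: "\<And>n. N \<le> n \<Longrightarrow> linear_regression (M n) n (k n) (X n) (\<theta> n) (\<sigma> n) (u n) (Y n)"
    and eta_pos: "\<And>n j. N \<le> n \<Longrightarrow> j < k n \<Longrightarrow> 0 < \<eta> n j"
    and standing: "\<And>j. eventually (\<lambda>n. j < k n) sequentially \<Longrightarrow>
        bdd_above ((\<lambda>n. (xi (X n) j)\<^sup>2 / real n) ` {n. N \<le> n \<and> j < k n})"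
    and index: "eventually (\<lambda>n. i < k n) sequentially"
    and consistent: "(\<lambda>n. xi (X n) i * \<eta> n i) \<longlonglongrightarrow> 0"
    and tuning: "filterlim (\<lambda>n. sqrt (real n) * \<eta> n i) at_top sequentially"
    and zeta: "(\<lambda>n. ereal ((\<theta> n $ i) / (\<sigma> n * xi (X n) i * \<eta> n i))) \<longlonglongrightarrow> \<zeta>"
    and H: "\<And>n. H n = cdf (distr (M n) borel
        (\<lambda>\<omega>. inverse (\<sigma> n) * inverse (xi (X n) i * \<eta> n i) *
              (theta_AS (X n) (\<eta> n) (Y n \<omega>) i - \<theta> n $ i)))"
  shows
    "(\<forall>m. eventually (\<lambda>n. n - k n = m) sequentially \<longrightarrow>
       (\<forall>z. \<zeta> = ereal z \<longrightarrow>
         (\<exists>\<mu>. real_distribution \<mu> \<and> weak_conv H (cdf \<mu>) \<and>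
            (0 \<le> z \<longrightarrow> (\<forall>x.
               cdf \<mu> x = (LINT s:{sqrt \<bar>x * z\<bar>..}|lborel. rho m s) * indicator {-z..<0} x
                         + indicator {0..} x \<and>
               cdf \<mu> x = measure (chi_square m) {real m * \<bar>x * z\<bar><..} * indicator {-z..<0} x
                         + indicator {0..} x)) \<and>
            (z < 0 \<longrightarrow> (\<forall>x.
               cdf \<mu> x = (LINT s:{0..sqrt \<bar>x * z\<bar>}|lborel. rho m s) * indicator {0..<-z} x
                         + indicator {-z..} x \<and>
               cdf \<mu> x = measure (chi_square m) {..real m * \<bar>x * z\<bar>} * indicator {0..<-z} x
                         + indicator {-z..} x)) \<and>
            measure \<mu> {-z} = (LINT s:{\<bar>z\<bar>..}|lborel. rho m s) \<and>
            measure \<mu> {-z} = measure (chi_square m) {real m * z\<^sup>2<..} \<and>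
            absolutely_continuous lborel (density \<mu> (indicator (- {-z}))) \<and>
            (z = 0 \<longrightarrow> \<mu> = return borel 0))) \<and>
       (\<bar>\<zeta>\<bar> = \<infinity> \<longrightarrow> weak_conv H (cdf (return borel 0)))) \<and>
     (filterlim (\<lambda>n. n - k n) at_top sequentially \<longrightarrow>
       (\<forall>z. \<zeta> = ereal z \<and> \<bar>z\<bar> \<le> 1 \<longrightarrow> weak_conv H (cdf (return borel (- z)))) \<and>
       (\<forall>z. \<zeta> = ereal z \<and> 1 < \<bar>z\<bar> \<longrightarrow> weak_conv H (cdf (return borel (- 1 / z)))) \<and>
       (\<bar>\<zeta>\<bar> = \<infinity> \<longrightarrow> weak_conv H (cdf (return borel 0))))"
proof -
  define t where "t n = (\<theta> n $ i) / (\<sigma> n * xi (X n) i * \<eta> n i)" for n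
  define T where "T n \<omega> = inverse (\<sigma> n) * inverse (xi (X n) i * \<eta> n i) *
              (theta_AS (X n) (\<eta> n) (Y n \<omega>) i - \<theta> n $ i)" for n \<omega>
  define r where "r n = n - k n" for n
  define P where "P n W q \<longleftrightarrow> W \<in> borel_measurable (M n) \<and> q \<in> borel_measurable (M n) \<and>
    (\<forall>\<omega>. 0 \<le> q \<omega>) \<and> integrable (M n) (\<lambda>\<omega>. (W \<omega>)\<^sup>2) \<and>
    (LINT \<omega>|M n. (W \<omega>)\<^sup>2) = 1 / (real n * (\<eta> n i)\<^sup>2) \<and>
    distr (M n) borel (\<lambda>\<omega>. real (r n) * q \<omega>) = chi_square (r n) \<and>
    (\<forall>\<omega>\<in>space (M n). T n \<omega> = W \<omega> - shrink (t n + W \<omega>) (q \<omega>))"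
    for n and W q :: "'a \<Rightarrow> real"
  define good where "good n \<longleftrightarrow> N \<le> n \<and> i < k n" for n
  have good: "eventually good sequentially"
    using eventually_conj[OF eventually_ge_at_top[of N] index] unfolding good_def[abs_def] .
  have "\<forall>n. \<exists>W q. good n \<longrightarrow> P n W q"
  proof
    fix n
    show "\<exists>W q. good n \<longrightarrow> P n W q"
    proof (cases "good n")
      case True
      hence lr: "linear_regression (M n) n (k n) (X n) (\<theta> n) (\<sigma> n) (u n) (Y n)"
        and ik: "i < k n" and eta: "0 < \<eta> n i"
        using model eta_pos by (auto simp: good_def)
      have "\<exists>W q. P n W q"
      proof (rule linear_regression_canonical_form[where \<eta> = "\<eta> n", OF lr ik eta], goal_cases)
        case (1 W q)
        show ?case
          unfolding P_def t_def T_def r_def using 1 by blast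
      qed
      thus ?thesis by blast
    qed simp
  qed
  then obtain W q where WQ: "\<And>n. good n \<Longrightarrow> P n (W n) (q n)"
    by metis
  have W_meas: "W n \<in> borel_measurable (M n)" and q_meas: "q n \<in> borel_measurable (M n)"
    and q_nonneg: "0 \<le> q n \<omega>"
    and W_square: "integrable (M n) (\<lambda>\<omega>. (W n \<omega>)\<^sup>2)"
      "(LINT \<omega>|M n. (W n \<omega>)\<^sup>2) = 1 / (real n * (\<eta> n i)\<^sup>2)"
    and q_law: "distr (M n) borel (\<lambda>\<omega>. real (r n) * q n \<omega>) = chi_square (r n)"
    if "good n" for n \<omega>
    using WQ[OF that] by (auto simp: P_def)
  have T_eq: "T n \<omega> = W n \<omega> - shrink (t n + W n \<omega>) (q n \<omega>)" if "good n" "\<omega> \<in> space (M n)" for n \<omega>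
    using WQ[OF that(1)] that(2) by (auto simp: P_def)
  have prob: "eventually (\<lambda>n. prob_space (M n)) sequentially"
    using good by eventually_elim (use model in \<open>auto simp: good_def linear_regression_def\<close>)
  have r_pos: "0 < r n" if "good n" for n
    using model[of n] that by (auto simp: good_def r_def linear_regression_def)
  have measT: "eventually (\<lambda>n. T n \<in> borel_measurable (M n)) sequentially"
    using good
  proof eventually_elim
    case (elim n)
    have "(\<lambda>\<omega>. W n \<omega> - shrink (t n + W n \<omega>) (q n \<omega>)) \<in> borel_measurable (M n)"
      using W_meas[OF elim] q_meas[OF elim]
      by (intro borel_measurable_diff measurable_shrink borel_measurable_add) simp_all
    thus ?case using T_eq[OF elim] by (simp cong: measurable_cong)
  qed
  have HT: "eventually (\<lambda>n. H n = cdf (distr (M n) borel (T n))) sequentially"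
    using H by (simp add: T_def[abs_def])
  have vanW: "vanishes_in_prob M W"
  proof (rule vanishes_in_probI_second_moment)
    show "\<forall>\<^sub>F n in sequentially. prob_space (M n) \<and> integrable (M n) (\<lambda>\<omega>. (W n \<omega>)\<^sup>2)"
      using prob good by eventually_elim (simp add: W_square)
    have "(\<lambda>n. (inverse (sqrt (real n) * \<eta> n i))\<^sup>2) \<longlonglongrightarrow> 0\<^sup>2"
      by (intro tendsto_power tendsto_inverse_0_at_top tuning)
    hence "(\<lambda>n. (inverse (sqrt (real n) * \<eta> n i))\<^sup>2) \<longlonglongrightarrow> 0" by simp
    thus "(\<lambda>n. LINT \<omega>|M n. (W n \<omega>)\<^sup>2) \<longlonglongrightarrow> 0"
    proof (rule Lim_transform_eventually)
      show "\<forall>\<^sub>F n in sequentially. (inverse (sqrt (real n) * \<eta> n i))\<^sup>2 = (LINT \<omega>|M n. (W n \<omega>)\<^sup>2)"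
        using good by eventually_elim (simp add: W_square power_mult_distrib inverse_eq_divide power_divide)
    qed
  qed
  have measW: "eventually (\<lambda>n. W n \<in> borel_measurable (M n)) sequentially"
    using good by eventually_elim (rule W_meas)
  have zeta': "(\<lambda>n. ereal (t n)) \<longlonglongrightarrow> \<zeta>" using zeta by (simp add: t_def)
  \<comment> \<open>The error \<open>W\<close> enters twice: once directly and once through the first argument of \<open>shrink\<close>.\<close>
  have T_close: "\<bar>T n \<omega> + shrink z (q n \<omega>)\<bar> \<le> 2 * \<bar>W n \<omega>\<bar> + \<bar>t n - z\<bar>"
    if "good n" "\<omega> \<in> space (M n)" for n \<omega> z
  proof -
    have "\<bar>shrink z (q n \<omega>) - shrink (t n + W n \<omega>) (q n \<omega>)\<bar> \<le> \<bar>z - (t n + W n \<omega>)\<bar>"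
      by (intro shrink_lipschitz q_nonneg[OF that(1)])
    thus ?thesis using T_eq[OF that] by linarith
  qed
  have tz: "(\<lambda>n. \<bar>t n - z\<bar>) \<longlonglongrightarrow> 0" if "\<zeta> = ereal z" for z
  proof -
    have "t \<longlonglongrightarrow> z" using zeta' that by simp
    from tendsto_rabs[OF tendsto_diff[OF this tendsto_const[of z]]] show ?thesis by simp
  qed
  have infinite_case: "weak_conv H (cdf (return borel 0))" if "\<bar>\<zeta>\<bar> = \<infinity>"
  proof (rule weak_conv_const[OF prob measT _ HT])
    note inf = tendsto_inverse_abs_infinite[OF zeta' that]
    \<comment> \<open>Compare with \<open>shrink (t n) (q n)\<close>, which is at most \<open>q n / \<bar>t n\<bar>\<close> in absolute value;
      this bound has mean \<open>1 / \<bar>t n\<bar>\<close>.\<close>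
    define g where "g n \<omega> = q n \<omega> / \<bar>t n\<bar>" for n \<omega>
    have vang: "vanishes_in_prob M g"
    proof (rule vanishes_in_probI_first_moment)
      show "\<forall>\<^sub>F n in sequentially. prob_space (M n) \<and> integrable (M n) (g n)"
        using prob good
      proof eventually_elim
        case (elim n)
        have "integrable (M n) (q n)"
          by (rule chi_square_ratio_moments(1)[OF elim(1) q_meas[OF elim(2)] r_pos[OF elim(2)] q_law[OF elim(2)]])
        thus ?case using elim(1) by (simp add: g_def[abs_def])
      qed
      show "(\<lambda>n. LINT \<omega>|M n. \<bar>g n \<omega>\<bar>) \<longlonglongrightarrow> 0"
      proof (rule Lim_transform_eventually[OF inf(1)])
        show "\<forall>\<^sub>F n in sequentially. 1 / \<bar>t n\<bar> = (LINT \<omega>|M n. \<bar>g n \<omega>\<bar>)"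
          using prob good
        proof eventually_elim
          case (elim n)
          have "(LINT \<omega>|M n. q n \<omega>) = 1"
            by (rule chi_square_ratio_moments(2)[OF elim(1) q_meas[OF elim(2)] r_pos[OF elim(2)] q_law[OF elim(2)]])
          moreover have "\<bar>g n \<omega>\<bar> = q n \<omega> / \<bar>t n\<bar>" for \<omega>
            using q_nonneg[OF elim(2)] by (simp add: g_def)
          ultimately show ?case by simp
        qed
      qed
    qed
    show "vanishes_in_prob M (\<lambda>n \<omega>. T n \<omega> - 0)"
    proof (rule vanishes_in_prob_dominated[OF prob _ vanW vang tendsto_const])
      show "\<forall>\<^sub>F n in sequentially. W n \<in> borel_measurable (M n) \<and> g n \<in> borel_measurable (M n)"
        using good by eventually_elim (unfold g_def[abs_def], intro conjI borel_measurable_divide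
            borel_measurable_diff borel_measurable_const W_meas q_meas)
      show "\<forall>\<^sub>F n in sequentially. \<forall>\<omega>\<in>space (M n). \<bar>T n \<omega> - 0\<bar> \<le> 2 * \<bar>W n \<omega>\<bar> + \<bar>g n \<omega>\<bar> + 0"
        using good inf(2)
      proof eventually_elim
        case (elim n)
        show ?case
        proof
          fix \<omega> assume "\<omega> \<in> space (M n)"
          from T_close[OF elim(1) this, of "t n"]
          have "\<bar>T n \<omega> + shrink (t n) (q n \<omega>)\<bar> \<le> 2 * \<bar>W n \<omega>\<bar>" by simp
          moreover have "\<bar>shrink (t n) (q n \<omega>)\<bar> \<le> \<bar>g n \<omega>\<bar>"
            using abs_shrink_le[OF q_nonneg[OF elim(1)] elim(2), of \<omega>] q_nonneg[OF elim(1), of \<omega>] by (simp add: g_def)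
          ultimately show "\<bar>T n \<omega> - 0\<bar> \<le> 2 * \<bar>W n \<omega>\<bar> + \<bar>g n \<omega>\<bar> + 0" by linarith
        qed
      qed
    qed
  qed
  have fixed_df: "weak_conv H (cdf (limit_law m z))"
    if m: "eventually (\<lambda>n. n - k n = m) sequentially" and z: "\<zeta> = ereal z" for m z
  proof (rule weak_conv_slutsky[where D = "\<lambda>n \<omega>. - shrink z (q n \<omega>)", OF real_distribution_limit_law prob _ _ _ HT])
    show "\<forall>\<^sub>F n in sequentially. T n \<in> borel_measurable (M n) \<and> (\<lambda>\<omega>. - shrink z (q n \<omega>)) \<in> borel_measurable (M n)"
      using measT good
      by eventually_elim (intro conjI borel_measurable_uminus measurable_shrink
          borel_measurable_const q_meas)
    show "\<forall>\<^sub>F n in sequentially. distr (M n) borel (\<lambda>\<omega>. - shrink z (q n \<omega>)) = limit_law m z"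
      using good m
    proof eventually_elim
      case (elim n)
      have m: "r n = m" "0 < m" using elim r_pos by (auto simp: r_def)
      note [measurable] = q_meas[OF elim(1)]
      have "limit_law m z = distr (distr (M n) borel (\<lambda>\<omega>. real m * q n \<omega>)) borel (\<lambda>c. - shrink z (c / real m))"
        using q_law[OF elim(1)] m by (simp add: limit_law_def)
      also have "\<dots> = distr (M n) borel ((\<lambda>c. - shrink z (c / real m)) \<circ> (\<lambda>\<omega>. real m * q n \<omega>))"
        by (rule distr_distr) measurable
      also have "(\<lambda>c. - shrink z (c / real m)) \<circ> (\<lambda>\<omega>. real m * q n \<omega>) = (\<lambda>\<omega>. - shrink z (q n \<omega>))"
        using m by (simp add: fun_eq_iff)
      finally show ?case ..
    qed
    show "vanishes_in_prob M (\<lambda>n \<omega>. T n \<omega> - - shrink z (q n \<omega>))"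
    proof (rule vanishes_in_prob_dominated[OF prob _ vanW vanW tz[OF z]])
      show "\<forall>\<^sub>F n in sequentially. W n \<in> borel_measurable (M n) \<and> W n \<in> borel_measurable (M n)"
        using measW by simp
      show "\<forall>\<^sub>F n in sequentially. \<forall>\<omega>\<in>space (M n).
          \<bar>T n \<omega> - - shrink z (q n \<omega>)\<bar> \<le> 2 * \<bar>W n \<omega>\<bar> + \<bar>W n \<omega>\<bar> + \<bar>t n - z\<bar>"
        using good
      proof eventually_elim
        case (elim n)
        show ?case
        proof
          fix \<omega> assume "\<omega> \<in> space (M n)"
          from T_close[OF elim this, of z]
          show "\<bar>T n \<omega> - - shrink z (q n \<omega>)\<bar> \<le> 2 * \<bar>W n \<omega>\<bar> + \<bar>W n \<omega>\<bar> + \<bar>t n - z\<bar>"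
            by linarith
        qed
      qed
    qed
  qed
  have growing_df: "weak_conv H (cdf (return borel (- shrink z 1)))"
    if top: "filterlim (\<lambda>n. n - k n) at_top sequentially" and z: "\<zeta> = ereal z" for z
  proof (rule weak_conv_const[OF prob measT _ HT])
    \<comment> \<open>Bounds the change in \<open>shrink z (q n)\<close> when \<open>q n\<close> is replaced by 1. For \<open>z = 0\<close> the quotient is 0
      by convention, in accordance with \<open>shrink 0 q = 0\<close>.\<close>
    define g where "g n \<omega> = (q n \<omega> - 1) / z" for n \<omega>
    have vang: "vanishes_in_prob M g"
    proof (rule vanishes_in_probI_second_moment)
      have mom: "integrable (M n) (\<lambda>\<omega>. (q n \<omega> - 1)\<^sup>2)" "(LINT \<omega>|M n. (q n \<omega> - 1)\<^sup>2) = 2 / real (r n)"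
        if "good n" "prob_space (M n)" for n
        by (rule chi_square_ratio_moments[OF that(2) q_meas[OF that(1)] r_pos[OF that(1)] q_law[OF that(1)]])+
      show "\<forall>\<^sub>F n in sequentially. prob_space (M n) \<and> integrable (M n) (\<lambda>\<omega>. (g n \<omega>)\<^sup>2)"
        using prob good by eventually_elim (simp add: g_def power_divide mom)
      have "filterlim (\<lambda>n. real (r n)) at_top sequentially"
        unfolding r_def by (rule filterlim_compose[OF filterlim_real_sequentially top])
      from tendsto_mult_right[OF tendsto_inverse_0_at_top[OF this], of "2 / z\<^sup>2"]
      have lim: "(\<lambda>n. 2 / real (r n) / z\<^sup>2) \<longlonglongrightarrow> 0" by (simp add: field_simps)
      show "(\<lambda>n. LINT \<omega>|M n. (g n \<omega>)\<^sup>2) \<longlonglongrightarrow> 0"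
      proof (rule Lim_transform_eventually[OF lim])
        show "\<forall>\<^sub>F n in sequentially. 2 / real (r n) / z\<^sup>2 = (LINT \<omega>|M n. (g n \<omega>)\<^sup>2)"
          using prob good by eventually_elim (simp add: g_def power_divide mom)
      qed
    qed
    show "vanishes_in_prob M (\<lambda>n \<omega>. T n \<omega> - - shrink z 1)"
    proof (rule vanishes_in_prob_dominated[OF prob _ vanW vang tz[OF z]])
      show "\<forall>\<^sub>F n in sequentially. W n \<in> borel_measurable (M n) \<and> g n \<in> borel_measurable (M n)"
        using good by eventually_elim (unfold g_def[abs_def], intro conjI borel_measurable_divide
            borel_measurable_diff borel_measurable_const W_meas q_meas)
      show "\<forall>\<^sub>F n in sequentially. \<forall>\<omega>\<in>space (M n).
          \<bar>T n \<omega> - - shrink z 1\<bar> \<le> 2 * \<bar>W n \<omega>\<bar> + \<bar>g n \<omega>\<bar> + \<bar>t n - z\<bar>"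
        using good
      proof eventually_elim
        case (elim n)
        show ?case
        proof
          fix \<omega> assume "\<omega> \<in> space (M n)"
          from T_close[OF elim this, of z] shrink_lipschitz_right[of z "q n \<omega>" 1]
          show "\<bar>T n \<omega> - - shrink z 1\<bar> \<le> 2 * \<bar>W n \<omega>\<bar> + \<bar>g n \<omega>\<bar> + \<bar>t n - z\<bar>"
            unfolding g_def abs_divide by linarith
        qed
      qed
    qed
  qed
  have df_pos: "0 < m" if "eventually (\<lambda>n. n - k n = m) sequentially" for m
  proof -
    from eventually_conj[OF that good] obtain n where "n - k n = m" "good n"
      by (auto simp: eventually_sequentially)
    thus ?thesis using r_pos[of n] by (simp add: r_def)
  qed
  have fixed_df_full: "\<exists>\<mu>. real_distribution \<mu> \<and> weak_conv H (cdf \<mu>) \<and>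
            (0 \<le> z \<longrightarrow> (\<forall>x.
               cdf \<mu> x = (LINT s:{sqrt \<bar>x * z\<bar>..}|lborel. rho m s) * indicator {-z..<0} x
                         + indicator {0..} x \<and>
               cdf \<mu> x = measure (chi_square m) {real m * \<bar>x * z\<bar><..} * indicator {-z..<0} x
                         + indicator {0..} x)) \<and>
            (z < 0 \<longrightarrow> (\<forall>x.
               cdf \<mu> x = (LINT s:{0..sqrt \<bar>x * z\<bar>}|lborel. rho m s) * indicator {0..<-z} x
                         + indicator {-z..} x \<and>
               cdf \<mu> x = measure (chi_square m) {..real m * \<bar>x * z\<bar>} * indicator {0..<-z} x
                         + indicator {-z..} x)) \<and>
            measure \<mu> {-z} = (LINT s:{\<bar>z\<bar>..}|lborel. rho m s) \<and>
            measure \<mu> {-z} = measure (chi_square m) {real m * z\<^sup>2<..} \<and>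
            absolutely_continuous lborel (density \<mu> (indicator (- {-z}))) \<and>
            (z = 0 \<longrightarrow> \<mu> = return borel 0)"
    if ev: "eventually (\<lambda>n. n - k n = m) sequentially" and z: "\<zeta> = ereal z" for m z
  proof -
    have m: "0 < m" by (rule df_pos[OF ev])
    have "(LINT s:{\<bar>z\<bar>..}|lborel. rho m s) = measure (chi_square m) {real m * z\<^sup>2<..}"
      using set_integral_rho_atLeast[OF m, of "z\<^sup>2"] by simp
    with fixed_df[OF ev z] show ?thesis
      by (intro exI[of _ "limit_law m z"] conjI impI allI)
        (simp_all only: real_distribution_limit_law cdf_limit_law_nonneg[OF m] cdf_limit_law_neg[OF m]
          set_integral_rho_atLeast[OF m abs_ge_zero] set_integral_rho_atLeastAtMost[OF m abs_ge_zero]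
          limit_law_atom[OF m] absolutely_continuous_limit_law_off_atom[OF m] limit_law_0)
  qed
  show ?thesis
  proof (intro conjI allI impI)
    fix z assume top: "filterlim (\<lambda>n. n - k n) at_top sequentially"
    {
      assume "\<zeta> = ereal z \<and> \<bar>z\<bar> \<le> 1"
      thus "weak_conv H (cdf (return borel (- z)))"
        using growing_df[OF top, of z] by (simp add: shrink_1)
    next
      assume "\<zeta> = ereal z \<and> 1 < \<bar>z\<bar>"
      thus "weak_conv H (cdf (return borel (- 1 / z)))"
        using growing_df[OF top, of z] by (simp add: shrink_1)
    }
  qed (rule fixed_df_full infinite_case, assumption+)+
qed

end
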